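(* Let $\Omega\subset\mathbb{R}^n$ be a bounded domain. Suppose that $\Sigma_0$ and $\Sigma_1$ are nonparametric minimal submanifolds which are the graphs of $f_0:\Omega\subset\mathbb{R}^n\to\mathbb{R}^m$ and $f_1:\Omega\subset\mathbb{R}^n\to\mathbb{R}^m$ respectively. If both $f_0$ and $f_1$ are distance-decreasing and $f_0=f_1$ on $\partial\Omega$, then $\Sigma_0=\Sigma_1$.
   Context: A $C^2$ vector-valued function $f=(f^1,\dots,f^m):\Omega\to\mathbb{R}^m$ on a bounded domain $\Omega\subset\mathbb{R}^n$ is a solution to the minimal surface system if $$\sum_{i,j=1}^n\frac{\partial}{\partial x^i}\left(\sqrt{g}\,g^{ij}\frac{\partial f^\alpha}{\partial x^j}\right)=0\quad\text{for each }\alpha=1,\dots,m,$$ where $g_{ij}=\delta_{ij}+\sum_\alpha\frac{\partial f^\alpha}{\partial x^i}\frac{\partial f^\alpha}{\partial x^j}$, $g=\det(g_{ij})$ and $(g^{ij})$ is the inverse matrix of $(g_{ij})$. The graph $\{(x,f(x)):x\in\Omega\}\subset\mathbb{R}^n\times\mathbb{R}^m$ of such an $f$ is called a nonparametric minimal submanifold. A map $f:\Omega\to\mathbb{R}^m$ is called distance-decreasing if $|df(v)|\le|v|$ at each point of $\Omega$ for every nonzero $v\in\mathbb{R}^n$. The boundary condition $f_0=f_1$ on $\partial\Omega$ is understood for maps that extend continuously to the closure $\overline{\Omega}$. *)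

theory Defs
  imports "HOL-Analysis.Analysis"
begin

text \<open>
  \<open>Ck_on k S f\<close> is the usual notion of a \<open>k\<close> times continuously differentiable function
  when \<open>S\<close> is open: on a finite-dimensional domain, continuity of \<open>x \<mapsto> Df(x)\<close> is the same as
  continuity of \<open>x \<mapsto> Df(x) v\<close> for every fixed \<open>v\<close>.
\<close>

primrec Ck_on ::
  "nat \<Rightarrow> 'a::euclidean_space set \<Rightarrow> ('a \<Rightarrow> 'b::real_normed_vector) \<Rightarrow> bool" where
  "Ck_on 0 S f \<longleftrightarrow> continuous_on S f"
| "Ck_on (Suc k) S f \<longleftrightarrow>
     (\<forall>x\<in>S. f differentiable (at x)) \<and>
     (\<forall>v. Ck_on k S (\<lambda>x. frechet_derivative f (at x) v))"

definition partial_deriv :: "'n::finite \<Rightarrow> (real^'n \<Rightarrow> real) \<Rightarrow> real^'n \<Rightarrow> real" where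
  "partial_deriv i u x = frechet_derivative u (at x) (axis i 1)"

definition induced_metric :: "(real^'n \<Rightarrow> real^'m) \<Rightarrow> real^'n \<Rightarrow> real^'n^'n" where
  "induced_metric f x =
     (\<chi> i j. (if i = j then 1 else 0) +
        (\<Sum>\<alpha>\<in>UNIV. partial_deriv i (\<lambda>y. f y $ \<alpha>) x * partial_deriv j (\<lambda>y. f y $ \<alpha>) x))"

text \<open>
  The metric is positive definite wherever \<open>f\<close> is differentiable, so \<open>matrix_inv\<close> below is the
  genuine inverse and \<open>sqrt\<close> is applied to a positive number.
\<close>

definition minimal_surface_system :: "(real^'n) set \<Rightarrow> (real^'n \<Rightarrow> real^'m) \<Rightarrow> bool" where
  "minimal_surface_system \<Omega> f \<longleftrightarrow>
     Ck_on 2 \<Omega> f \<and>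
     (\<forall>x\<in>\<Omega>. \<forall>\<alpha>.
        (\<Sum>i\<in>UNIV. \<Sum>j\<in>UNIV.
           partial_deriv i
             (\<lambda>y. sqrt (det (induced_metric f y)) * matrix_inv (induced_metric f y) $ i $ j *
                  partial_deriv j (\<lambda>z. f z $ \<alpha>) y) x) = 0)"

definition distance_decreasing_on :: "(real^'n) set \<Rightarrow> (real^'n \<Rightarrow> real^'m) \<Rightarrow> bool" where
  "distance_decreasing_on \<Omega> f \<longleftrightarrow>
     (\<forall>x\<in>\<Omega>. \<forall>v. v \<noteq> 0 \<longrightarrow> norm (frechet_derivative f (at x) v) \<le> norm v)"

definition graph_over :: "'a set \<Rightarrow> ('a \<Rightarrow> 'b) \<Rightarrow> ('a \<times> 'b) set" where
  "graph_over \<Omega> f = {(x, f x) | x. x \<in> \<Omega>}"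

definition nonparametric_minimal_submanifold ::
  "(real^'n) set \<Rightarrow> (real^'n \<Rightarrow> real^'m) \<Rightarrow> ((real^'n) \<times> (real^'m)) set \<Rightarrow> bool" where
  "nonparametric_minimal_submanifold \<Omega> f \<Sigma> \<longleftrightarrow>
     minimal_surface_system \<Omega> f \<and> \<Sigma> = graph_over \<Omega> f"

end

theory Submission imports Defs begin

text \<open>
  Let \<open>F p = sqrt (det (1 + p\<^sup>T p))\<close> be the area integrand; the system says that the rows of the flux
  \<open>DF (df)\<close> are divergence free. On the closed unit ball of the operator norm \<open>DF\<close> is strictly
  monotone: along a segment with direction \<open>q\<close>, put \<open>H = (1 + p\<^sup>T p)\<^sup>-\<^sup>1\<close>, \<open>K = (1 + p p\<^sup>T)\<^sup>-\<^sup>1\<close> and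
  \<open>c = K q H\<close>; then \<open>D\<^sup>2F(q, q) / F = (p H \<bullet> q)\<^sup>2 + (c - p c\<^sup>T p) \<bullet> q\<close>, and expanding
  \<open>q = (1 + p p\<^sup>T) c (1 + p\<^sup>T p)\<close> shows that the last term is nonnegative when \<open>|p| \<le> 1\<close>. It vanishes
  only if \<open>c = p c\<^sup>T p\<close>, in which case \<open>p\<close> is isometric on the rows of \<open>c\<close>, and the parallelogram
  identity at the midpoint of a segment inside the unit ball forces \<open>q = 0\<close>.

  Nothing is assumed about the derivatives at the boundary, so the difference of the two flux rows is
  tested componentwise with a truncation \<open>\<psi> (u\<^sub>\<alpha>)\<close> of \<open>u = f\<^sub>1 - f\<^sub>0\<close>, which has compact support in
  \<open>\<Omega>\<close>. Removing the truncation is harmless because \<open>{u\<^sub>\<alpha> = 0, du\<^sub>\<alpha> \<noteq> 0}\<close> is a null set, and strict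
  monotonicity then gives \<open>du = 0\<close>.
\<close>

subsection \<open>Continuously differentiable functions\<close>

lemma C1_I:
  assumes "\<And>x. x \<in> S \<Longrightarrow> (f has_derivative f' x) (at x)"
    and "\<And>v. continuous_on S (\<lambda>x. f' x v)"
  shows "Ck_on (Suc 0) S f"
proof -
  have eq: "frechet_derivative f (at x) = f' x" if "x \<in> S" for x
    using frechet_derivative_at[OF assms(1)[OF that]] by simp
  have "continuous_on S (\<lambda>x. frechet_derivative f (at x) v)" for v
    using assms(2)[of v] by (simp add: eq cong: continuous_on_cong_simp)
  then show ?thesis
    using assms(1) by (auto simp: differentiable_def)
qed

lemma C1_has_derivative:
  "Ck_on (Suc 0) S f \<Longrightarrow> x \<in> S \<Longrightarrow> (f has_derivative frechet_derivative f (at x)) (at x)"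
  by (simp add: frechet_derivative_works[symmetric])

lemma C1_continuous_derivative:
  "Ck_on (Suc 0) S f \<Longrightarrow> continuous_on S (\<lambda>x. frechet_derivative f (at x) v)"
  by simp

lemma C1_continuous: "Ck_on (Suc 0) S f \<Longrightarrow> continuous_on S f"
  by (metis C1_has_derivative continuous_at_imp_continuous_on has_derivative_continuous)

lemma C1_const: "Ck_on (Suc 0) S (\<lambda>x. c)"
  by (rule C1_I[where f' = "\<lambda>_ _. 0"]) auto

lemma C1_linear: "bounded_linear f \<Longrightarrow> Ck_on (Suc 0) S f"
  by (rule C1_I[where f' = "\<lambda>_. f"]) (auto intro: bounded_linear_imp_has_derivative)

lemma C1_add:
  assumes "Ck_on (Suc 0) S f" "Ck_on (Suc 0) S g"
  shows "Ck_on (Suc 0) S (\<lambda>x. f x + g x)"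
  by (rule C1_I[OF has_derivative_add[OF C1_has_derivative[OF assms(1)] C1_has_derivative[OF assms(2)]]])
     (auto intro!: continuous_intros C1_continuous_derivative assms simp del: Ck_on.simps)

lemma C1_mult:
  fixes f g :: "'a::euclidean_space \<Rightarrow> real"
  assumes "Ck_on (Suc 0) S f" "Ck_on (Suc 0) S g"
  shows "Ck_on (Suc 0) S (\<lambda>x. f x * g x)"
  by (rule C1_I[OF has_derivative_mult[OF C1_has_derivative[OF assms(1)] C1_has_derivative[OF assms(2)]]])
     (auto intro!: continuous_on_add continuous_on_mult C1_continuous_derivative[OF assms(1)]
        C1_continuous_derivative[OF assms(2)] C1_continuous[OF assms(1)] C1_continuous[OF assms(2)]
        simp del: Ck_on.simps)

lemma C1_sum:
  assumes "\<And>i. i \<in> I \<Longrightarrow> Ck_on (Suc 0) S (f i)"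
  shows "Ck_on (Suc 0) S (\<lambda>x. \<Sum>i\<in>I. f i x)"
  using assms
proof (induction I rule: infinite_finite_induct)
  case (insert i I)
  then show ?case
    using C1_add[of S "f i" "\<lambda>x. \<Sum>i\<in>I. f i x"] by simp
qed (simp_all add: C1_const del: Ck_on.simps)

lemma C1_prod:
  fixes f :: "'i \<Rightarrow> 'a::euclidean_space \<Rightarrow> real"
  assumes "\<And>i. i \<in> I \<Longrightarrow> Ck_on (Suc 0) S (f i)"
  shows "Ck_on (Suc 0) S (\<lambda>x. \<Prod>i\<in>I. f i x)"
  using assms
proof (induction I rule: infinite_finite_induct)
  case (insert i I)
  then show ?case
    using C1_mult[of S "f i" "\<lambda>x. \<Prod>i\<in>I. f i x"] by simp
qed (simp_all add: C1_const del: Ck_on.simps)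

text \<open>The outer function need only be differentiable at the values that \<open>f\<close>
  takes, so that \<open>sqrt\<close> qualifies for positive and \<open>inverse\<close> for nonzero
  arguments.\<close>

lemma C1_chain:
  fixes f :: "'a::euclidean_space \<Rightarrow> real"
  assumes "Ck_on (Suc 0) S f"
    and "\<And>x. x \<in> S \<Longrightarrow> (g has_real_derivative g' (f x)) (at (f x))"
    and "continuous_on (f ` S) g'"
  shows "Ck_on (Suc 0) S (\<lambda>x. g (f x))"
proof (rule C1_I)
  show "((\<lambda>x. g (f x)) has_derivative (\<lambda>v. g' (f x) * frechet_derivative f (at x) v)) (at x)"
    if "x \<in> S" for x
    using has_derivative_compose[OF C1_has_derivative[OF assms(1) that]
        assms(2)[OF that, unfolded has_field_derivative_def]] .
  show "continuous_on S (\<lambda>x. g' (f x) * frechet_derivative f (at x) v)" for v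
    by (intro continuous_intros C1_continuous_derivative assms(1)
        continuous_on_compose2[OF assms(3) C1_continuous[OF assms(1)]]) auto
qed

lemma C1_sqrt:
  fixes f :: "'a::euclidean_space \<Rightarrow> real"
  assumes "Ck_on (Suc 0) S f" "\<And>x. x \<in> S \<Longrightarrow> f x > 0"
  shows "Ck_on (Suc 0) S (\<lambda>x. sqrt (f x))"
proof (rule C1_chain[OF assms(1)])
  show "(sqrt has_real_derivative inverse (sqrt (f x)) / 2) (at (f x))" if "x \<in> S" for x
    using DERIV_real_sqrt assms(2) that by blast
  show "continuous_on (f ` S) (\<lambda>y. inverse (sqrt y) / 2)"
    using assms(2) by (intro continuous_intros) force+
qed

lemma C1_inverse:
  fixes f :: "'a::euclidean_space \<Rightarrow> real"
  assumes "Ck_on (Suc 0) S f" "\<And>x. x \<in> S \<Longrightarrow> f x \<noteq> 0"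
  shows "Ck_on (Suc 0) S (\<lambda>x. inverse (f x))"
proof (rule C1_chain[OF assms(1)])
  show "(inverse has_real_derivative - (inverse (f x) ^ Suc (Suc 0))) (at (f x))" if "x \<in> S" for x
    using DERIV_inverse[OF assms(2)[OF that]] .
  show "continuous_on (f ` S) (\<lambda>y. - (inverse y ^ Suc (Suc 0)))"
    using assms(2) by (intro continuous_intros) force+
qed

lemma C1_cong:
  assumes "open S" "Ck_on (Suc 0) S f" "\<And>x. x \<in> S \<Longrightarrow> f x = g x"
  shows "Ck_on (Suc 0) S g"
  by (rule C1_I[OF has_derivative_transform_within_open[OF C1_has_derivative[OF assms(2)] assms(1)]])
     (use assms(3) C1_continuous_derivative[OF assms(2)] in auto)

text \<open>Serves to extend functions by zero. Frechet derivatives are pointwise, so only their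
  continuity has to be pasted.\<close>

lemma C1_Un:
  assumes "open S" "open T" "Ck_on (Suc 0) S f" "Ck_on (Suc 0) T f"
  shows "Ck_on (Suc 0) (S \<union> T) f"
  using assms by (auto intro: continuous_on_open_Un)

lemma C1_det:
  fixes A :: "'a::euclidean_space \<Rightarrow> real^'k^'k"
  assumes "\<And>i j. Ck_on (Suc 0) S (\<lambda>x. A x $ i $ j)"
  shows "Ck_on (Suc 0) S (\<lambda>x. det (A x))"
  unfolding det_def by (intro C1_sum C1_mult C1_const C1_prod assms)

text \<open>Cramer's rule for the system solved by column \<open>j\<close> of the inverse. It writes
  each entry as a polynomial in the entries of \<open>A\<close> divided by \<open>det A\<close>,
  which is how smoothness passes to the inverse.\<close>

lemma matrix_inv_cramer:
  fixes A :: "real^'k^'k"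
  assumes "det A \<noteq> 0"
  shows "matrix_inv A $ i $ j =
    det (\<chi> a b. if b = i then axis j 1 $ a else A $ a $ b) * inverse (det A)"
proof -
  have "invertible A"
    using assms by (simp add: invertible_det_nz)
  then have "A ** matrix_inv A = mat 1"
    unfolding matrix_inv_def invertible_def by (metis (mono_tags, lifting) someI_ex)
  then have "A *v (matrix_inv A *v axis j 1) = axis j 1"
    by (simp add: matrix_vector_mul_assoc)
  then have "matrix_inv A *v axis j 1 =
      (\<chi> k. det (\<chi> a b. if b = k then axis j 1 $ a else A $ a $ b) / det A)"
    using cramer[OF assms] by blast
  moreover have "(matrix_inv A *v axis j 1) $ i = matrix_inv A $ i $ j"
    by (simp add: matrix_vector_mult_basis column_def)
  ultimately show ?thesis
    by (simp add: divide_inverse)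
qed

lemma C1_matrix_inv:
  fixes A :: "'a::euclidean_space \<Rightarrow> real^'k^'k"
  assumes "open S" "\<And>i j. Ck_on (Suc 0) S (\<lambda>x. A x $ i $ j)" "\<And>x. x \<in> S \<Longrightarrow> det (A x) \<noteq> 0"
  shows "Ck_on (Suc 0) S (\<lambda>x. matrix_inv (A x) $ i $ j)"
proof (rule C1_cong[OF assms(1)])
  have entry: "Ck_on (Suc 0) S (\<lambda>x. if b = i then axis j 1 $ a else A x $ a $ b)" for a b
    using C1_const[of S "axis j 1 $ a :: real"] assms(2)[of a b] by (cases "b = i") auto
  show "Ck_on (Suc 0) S (\<lambda>x. det (\<chi> a b. if b = i then axis j 1 $ a else A x $ a $ b) *
      inverse (det (A x)))"
    by (intro C1_mult C1_inverse C1_det assms) (use entry in simp)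
qed (simp add: matrix_inv_cramer assms(3))

subsection \<open>Matrices as a Euclidean space\<close>

lemma matrix_add_rdistrib: "((B :: real^'k^'m) + C) ** A = B ** A + C ** A"
  by (vector matrix_matrix_mult_def sum.distrib[symmetric] field_simps)

lemma matrix_diff_ldistrib: "A ** ((B :: real^'k^'m) - C) = A ** B - A ** C"
  by (vector matrix_matrix_mult_def sum_subtractf[symmetric] field_simps)

lemma matrix_minus_right: "A ** (- (B :: real^'k^'m)) = - (A ** B)"
  using matrix_diff_ldistrib[of A 0 B] by simp

lemma matrix_diff_rdistrib: "((B :: real^'k^'m) - C) ** A = B ** A - C ** A"
  by (vector matrix_matrix_mult_def sum_subtractf[symmetric] field_simps)

lemma transpose_add: "transpose ((A :: real^'n^'m) + B) = transpose A + transpose B"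
  by (vector transpose_def)

lemma transpose_diff: "transpose ((A :: real^'n^'m) - B) = transpose A - transpose B"
  by (vector transpose_def)

lemma inner_transpose: "transpose X \<bullet> transpose Y = X \<bullet> (Y :: real^'n^'m)"
  unfolding inner_vec_def transpose_def by (simp, rule sum.swap)

lemma norm_transpose: "norm (transpose X) = norm (X :: real^'n^'m)"
  by (simp add: norm_eq_sqrt_inner inner_transpose)

text \<open>As an iterated vector type, \<open>real^'n^'m\<close> carries the Frobenius inner
  product. The adjoint rule is an exchange of two finite sums within each row.\<close>

lemma inner_matrix_mult_right:
  fixes X :: "real^'k^'m" and B :: "real^'n^'k"
  shows "(X ** B) \<bullet> Y = X \<bullet> (Y ** transpose B)"
proof -
  have "(\<Sum>j\<in>UNIV. (\<Sum>k\<in>UNIV. X $ i $ k * B $ k $ j) * Y $ i $ j) =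
        (\<Sum>k\<in>UNIV. X $ i $ k * (\<Sum>j\<in>UNIV. Y $ i $ j * B $ k $ j))" for i
    unfolding sum_distrib_left sum_distrib_right
    by (subst sum.swap) (simp only: mult_ac)
  then show ?thesis
    by (simp add: inner_vec_def matrix_matrix_mult_def transpose_def)
qed

lemma inner_matrix_mult_left:
  fixes A :: "real^'k^'m" and X :: "real^'n^'k"
  shows "(A ** X) \<bullet> Y = X \<bullet> (transpose A ** Y)"
proof -
  have "(A ** X) \<bullet> Y = (transpose X ** transpose A) \<bullet> transpose Y"
    by (metis inner_transpose matrix_transpose_mul)
  also have "\<dots> = transpose X \<bullet> transpose (transpose A ** Y)"
    by (simp add: inner_matrix_mult_right matrix_transpose_mul)
  finally show ?thesis by (simp add: inner_transpose)
qed

lemma inner_mult_eq_transpose_left: "X \<bullet> (A ** Y) = (transpose A ** X) \<bullet> (Y :: real^'n^'k)"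
  by (metis inner_commute inner_matrix_mult_left)

lemma inner_mult_eq_transpose_right: "X \<bullet> (Y ** B) = (X ** transpose B) \<bullet> (Y :: real^'n^'k)"
  by (metis inner_commute inner_matrix_mult_right)

lemma trace_matrix_mult: "trace (A ** B) = transpose A \<bullet> (B :: real^'n^'n)"
  unfolding trace_def matrix_matrix_mult_def inner_vec_def transpose_def
  by (simp, rule sum.swap)

lemma bounded_bilinear_matrix_mult:
  "bounded_bilinear ((**) :: real^'k^'m \<Rightarrow> real^'n^'k \<Rightarrow> real^'n^'m)"
  unfolding bilinear_conv_bounded_bilinear[symmetric]
  by (auto simp: bilinear_def matrix_add_ldistrib matrix_add_rdistrib matrix_scalar_ac
      scalar_matrix_assoc intro!: linearI)

lemma has_vector_derivative_matrix:
  fixes A :: "real \<Rightarrow> real^'n^'m"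
  assumes "\<And>i j. ((\<lambda>t. A t $ i $ j) has_vector_derivative A' $ i $ j) (at t)"
  shows "(A has_vector_derivative A') (at t)"
  unfolding has_vector_derivative_def
proof (subst has_derivative_componentwise_within, safe)
  fix b :: "real^'n^'m" assume "b \<in> Basis"
  then obtain i j where b: "b = axis i (axis j 1)"
    by (auto simp: Basis_vec_def)
  show "((\<lambda>x. A x \<bullet> b) has_derivative (\<lambda>x. x *\<^sub>R A' \<bullet> b)) (at t)"
    using assms[of i j] by (simp add: b inner_axis has_vector_derivative_def)
qed

section \<open>Matrices of operator norm at most 1\<close>

text \<open>\<open>norm\<close> of a matrix is its Frobenius norm; the bound meant here is on the
  operator norm, hence the quantifier over vectors.\<close>

definition contraction :: "real^'n^'m \<Rightarrow> bool" where
  "contraction p \<longleftrightarrow> (\<forall>v. norm (p *v v) \<le> norm v)"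

text \<open>Cauchy-Schwarz bounds the square of \<open>norm (transpose p *v w)\<close> by its
  product with \<open>norm w\<close>; one factor cancels, and the claim is trivial if that factor is
  0.\<close>

lemma contraction_transpose:
  fixes p :: "real^'n^'m"
  assumes "contraction p"
  shows "contraction (transpose p)"
  unfolding contraction_def
proof
  fix w :: "real^'m"
  have "(norm (transpose p *v w))\<^sup>2 = w \<bullet> (p *v (transpose p *v w))"
    by (simp add: power2_norm_eq_inner dot_lmul_matrix)
  also have "\<dots> \<le> norm w * norm (transpose p *v w)"
    by (meson Cauchy_Schwarz_ineq2 abs_le_D1 assms contraction_def mult_left_mono norm_ge_zero order_trans)
  finally have "norm (transpose p *v w) * norm (transpose p *v w) \<le> norm w * norm (transpose p *v w)"
    by (simp add: power2_eq_square)
  then show "norm (transpose p *v w) \<le> norm w"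
    by (metis mult_le_cancel_right norm_ge_zero order_le_less)
qed

lemma row_mult_transpose: "(X ** transpose p) $ i = (p :: real^'n^'m) *v (X $ i)"
  by (simp add: vec_eq_iff matrix_matrix_mult_def transpose_def matrix_vector_mult_def mult.commute)

text \<open>Each row of the product is the image under \<open>p\<close> of a row of
  \<open>X\<close>, and the Frobenius norm is monotone in the norms of the rows.\<close>

lemma contraction_mult_right_transpose:
  assumes "contraction p"
  shows "norm (X ** transpose p) \<le> norm X"
  by (rule norm_le_componentwise_cart) (use assms in \<open>simp add: row_mult_transpose contraction_def\<close>)

lemma contraction_mult_right:
  assumes "contraction p"
  shows "norm (X ** p) \<le> norm X"
  using contraction_mult_right_transpose[OF contraction_transpose[OF assms], of X] by simp

lemma contraction_mult_left_transpose:
  assumes "contraction p"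
  shows "norm (transpose p ** X) \<le> norm X"
  using contraction_mult_right[OF assms, of "transpose X"]
  by (metis norm_transpose matrix_transpose_mul transpose_transpose)

lemma contraction_mult_left:
  assumes "contraction p"
  shows "norm (p ** X) \<le> norm X"
  using contraction_mult_left_transpose[OF contraction_transpose[OF assms]] by simp

lemma contraction_convex:
  fixes p q :: "real^'n^'m"
  assumes "contraction p" "contraction (p + q)" "0 \<le> t" "t \<le> 1"
  shows "contraction (p + t *\<^sub>R q)"
  unfolding contraction_def
proof
  fix v :: "real^'n"
  have "(p + t *\<^sub>R q) *v v = (1 - t) *\<^sub>R (p *v v) + t *\<^sub>R ((p + q) *v v)"
    by (simp add: algebra_simps scaleR_matrix_vector_assoc[symmetric])
  also have "norm \<dots> \<le> (1 - t) * norm (p *v v) + t * norm ((p + q) *v v)"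
    using assms(3,4) by (intro norm_triangle_le) simp
  also have "\<dots> \<le> (1 - t) * norm v + t * norm v"
    using assms by (intro add_mono mult_left_mono) (auto simp: contraction_def)
  finally show "norm ((p + t *\<^sub>R q) *v v) \<le> norm v"
    by (simp add: algebra_simps)
qed

lemma norm_le_inner_diff_nonneg:
  fixes x y :: "'a::real_inner"
  assumes "norm x \<le> norm y"
  shows "0 \<le> (y - x) \<bullet> y"
proof -
  have "x \<bullet> y \<le> norm y * norm y"
    by (meson assms mult_right_mono norm_cauchy_schwarz norm_ge_zero order_trans)
  then show ?thesis
    by (simp add: inner_diff_left norm_eq_sqrt_inner)
qed

text \<open>The equality case of the preceding estimate: under these assumptions the square of
  \<open>norm (y - x)\<close> equals \<open>x \<bullet> x - y \<bullet> y\<close>, which is at most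
  0.\<close>

lemma norm_le_inner_diff_zero:
  fixes x y :: "'a::real_inner"
  assumes "norm x \<le> norm y" "(y - x) \<bullet> y = 0"
  shows "x = y"
proof -
  have "x \<bullet> x \<le> y \<bullet> y"
    using assms(1) by (simp add: norm_le)
  then have "(y - x) \<bullet> (y - x) \<le> 0"
    using assms(2) by (simp add: inner_diff_left inner_diff_right inner_commute)
  then have "(y - x) \<bullet> (y - x) = 0"
    by (intro order_antisym inner_ge_zero)
  then show ?thesis
    by simp
qed

subsection \<open>Strict monotonicity of the flux\<close>

text \<open>Differentiate the Leibniz expansion. A permutation other than \<open>id\<close> moves at
  least two indices, so after one factor has been differentiated an off-diagonal entry of
  \<open>mat 1\<close> survives among the others. Only \<open>id\<close> contributes, and it gives
  the trace.\<close>

lemma has_real_derivative_det_mat_1: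
  fixes A :: "real \<Rightarrow> real^'k^'k"
  assumes A: "(A has_vector_derivative A') (at t)" and At: "A t = mat 1"
  shows "((\<lambda>s. det (A s)) has_real_derivative trace A') (at t)"
proof -
  have entry: "((\<lambda>s. A s $ i $ j) has_real_derivative A' $ i $ j) (at t)" for i j
    using bounded_linear.has_vector_derivative[OF bounded_linear_compose[OF
        bounded_linear_vec_nth bounded_linear_vec_nth] A, of i j]
    by (simp add: has_real_derivative_iff_has_vector_derivative)
  let ?D = "\<lambda>\<sigma>. \<Sum>i\<in>UNIV. A' $ i $ \<sigma> i * (\<Prod>j\<in>UNIV - {i}. A t $ j $ \<sigma> j)"
  have "((\<lambda>s. det (A s)) has_real_derivative
      (\<Sum>\<sigma> | \<sigma> permutes UNIV. of_int (sign \<sigma>) * ?D \<sigma>)) (at t)"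
    unfolding det_def
    by (intro DERIV_sum DERIV_cmult has_field_derivative_prod entry)
  also have "(\<Sum>\<sigma> | \<sigma> permutes UNIV. of_int (sign \<sigma>) * ?D \<sigma>) =
      (\<Sum>\<sigma>\<in>{id}. of_int (sign \<sigma>) * ?D \<sigma>)"
  proof (rule sum.mono_neutral_right)
    show "\<forall>\<sigma>\<in>{\<sigma>. \<sigma> permutes UNIV} - {id}. of_int (sign \<sigma>) * ?D \<sigma> = 0"
    proof
      fix \<sigma> :: "'k \<Rightarrow> 'k" assume \<sigma>: "\<sigma> \<in> {\<sigma>. \<sigma> permutes UNIV} - {id}"
      then obtain a where a: "\<sigma> a \<noteq> a" by fastforce
      have inj: "inj \<sigma>" using \<sigma> by (auto intro: permutes_inj)
      have "(\<Prod>j\<in>UNIV - {i}. A t $ j $ \<sigma> j) = 0" for i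
      proof -
        have "\<exists>j\<in>UNIV - {i}. \<sigma> j \<noteq> j"
        proof (cases "i = a")
          case True
          \<comment> \<open>The removed index is itself moved; by injectivity its image is a second
            moved index.\<close>
          then have "\<sigma> (\<sigma> a) \<noteq> \<sigma> a"
            using a inj by (auto dest: injD)
          then show ?thesis using True a by blast
        qed (use a in auto)
        then obtain j where "j \<in> UNIV - {i}" "\<sigma> j \<noteq> j" by blast
        then show ?thesis
          by (intro prod_zero bexI[of _ j]) (auto simp: At mat_def)
      qed
      then show "of_int (sign \<sigma>) * ?D \<sigma> = 0"
        by (simp only: mult_zero_right sum.neutral_const)
    qed
  qed (auto simp: permutes_id)
  also have "\<dots> = trace A'"
    by (simp add: At mat_def trace_def)
  finally show ?thesis .
qed

text \<open>Multiplying by the constant matrix \<open>B\<close> moves the base point to the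
  identity; \<open>det (A t) * det B = 1\<close> undoes the scaling.\<close>

lemma has_real_derivative_det:
  fixes A :: "real \<Rightarrow> real^'k^'k" and B :: "real^'k^'k"
  assumes A: "(A has_vector_derivative A') (at t)" and B: "B ** A t = mat 1"
  shows "((\<lambda>s. det (A s)) has_real_derivative det (A t) * trace (B ** A')) (at t)"
proof -
  have AB: "A t ** B = mat 1"
    using B by (simp add: matrix_left_right_inverse)
  have "((\<lambda>s. B ** A s) has_vector_derivative B ** A') (at t)"
    using bounded_linear.has_vector_derivative[OF
        bounded_bilinear.bounded_linear_right[OF bounded_bilinear_matrix_mult] A] .
  from DERIV_cmult[OF has_real_derivative_det_mat_1[OF this B], of "det (A t)"]
  have "((\<lambda>s. det (A t) * det (B ** A s)) has_real_derivative det (A t) * trace (B ** A')) (at t)" .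
  moreover have "det (A t) * det (B ** A s) = det (A s)" for s
    by (metis det_mul matrix_mul_assoc AB matrix_mul_lid)
  ultimately show ?thesis by simp
qed

section \<open>The metric of a graph and the gradient of its area\<close>

definition gram :: "real^'n^'m \<Rightarrow> real^'n^'n" where
  "gram p = mat 1 + transpose p ** p"

text \<open>The Frobenius gradient of the area integrand \<open>sqrt (det (gram p))\<close>. At the
  Jacobian of \<open>f\<close>, its rows are the vector fields whose divergence the system sets to
  zero.\<close>

definition flux :: "real^'n^'m \<Rightarrow> real^'n^'m" where
  "flux p = sqrt (det (gram p)) *\<^sub>R (p ** matrix_inv (gram p))"

text \<open>\<open>x \<bullet> (gram p *v x)\<close> is the sum of the squared lengths of
  \<open>x\<close> and \<open>p *v x\<close>, so the kernel is trivial.\<close>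

lemma invertible_gram: "invertible (gram p)"
proof -
  have "x = 0" if "gram p *v x = 0" for x
  proof -
    have "x \<bullet> ((p *v x) v* p) = (p *v x) \<bullet> (p *v x)"
      by (metis dot_lmul_matrix inner_commute)
    then have "x \<bullet> (gram p *v x) = x \<bullet> x + (p *v x) \<bullet> (p *v x)"
      by (simp add: gram_def matrix_vector_mult_add_rdistrib inner_add_right
          matrix_vector_mul_assoc[symmetric])
    then have "x \<bullet> x \<le> 0"
      using that by (simp add: add_nonneg_eq_0_iff)
    then show ?thesis
      using inner_gt_zero_iff[of x] by linarith
  qed
  then show ?thesis
    using invertible_left_inverse matrix_left_invertible_ker by blast
qed

lemma gram_mult_inv: "gram p ** matrix_inv (gram p) = mat 1"
  and inv_mult_gram: "matrix_inv (gram p) ** gram p = mat 1"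
  using invertible_gram[of p] unfolding matrix_inv_def invertible_def
  by (metis (mono_tags, lifting) someI_ex)+

lemma transpose_gram: "transpose (gram p) = gram p"
  by (simp add: gram_def transpose_add matrix_transpose_mul)

lemma transpose_inv_gram: "transpose (matrix_inv (gram p)) = matrix_inv (gram p)"
proof -
  have "transpose (matrix_inv (gram p)) ** gram p = mat 1"
    by (metis gram_mult_inv matrix_transpose_mul transpose_gram transpose_mat)
  then show ?thesis
    by (metis gram_mult_inv matrix_mul_assoc matrix_mul_lid matrix_mul_rid)
qed

lemma gram_entry_C1:
  fixes P :: "'a::euclidean_space \<Rightarrow> real^'n^'m"
  assumes "\<And>a i. Ck_on (Suc 0) S (\<lambda>x. P x $ a $ i)"
  shows "Ck_on (Suc 0) S (\<lambda>x. gram (P x) $ i $ j)"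
  unfolding gram_def matrix_matrix_mult_def transpose_def
  using C1_add[OF C1_const C1_sum[OF C1_mult[OF assms assms]]]
  by (simp del: Ck_on.simps)

text \<open>Invertibility keeps the determinant away from 0 along the segment from 0 to
  \<open>p\<close>. It starts at 1, so the intermediate value theorem excludes a nonpositive
  value.\<close>

lemma det_gram_pos: "det (gram p) > 0"
proof (rule ccontr)
  assume neg: "\<not> ?thesis"
  have "continuous_on {0..1} (\<lambda>t::real. det (gram (t *\<^sub>R p)))"
    by (intro C1_continuous C1_det gram_entry_C1) (auto intro!: C1_linear bounded_linear_mult_left simp del: Ck_on.simps)
  moreover have "det (gram (0 *\<^sub>R p)) = 1"
    by (simp add: gram_def transpose_def flip: zero_vec_def)
  ultimately obtain t :: real where "det (gram (t *\<^sub>R p)) = 0"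
    using IVT2'[of "\<lambda>t. det (gram (t *\<^sub>R p))" 1 0 0] neg by force
  then show False
    using invertible_gram invertible_det_nz by blast
qed

lemma flux_entry_C1:
  fixes P :: "'a::euclidean_space \<Rightarrow> real^'n^'m"
  assumes "open S" "\<And>a i. Ck_on (Suc 0) S (\<lambda>x. P x $ a $ i)"
  shows "Ck_on (Suc 0) S (\<lambda>x. flux (P x) $ a $ i)"
proof -
  have "Ck_on (Suc 0) S (\<lambda>x. sqrt (det (gram (P x))) *
      (\<Sum>k\<in>UNIV. P x $ a $ k * matrix_inv (gram (P x)) $ k $ i))"
    by (intro C1_mult C1_sqrt C1_sum C1_det gram_entry_C1 C1_matrix_inv assms det_gram_pos
        less_imp_neq[OF det_gram_pos, symmetric])
  then show ?thesis
    by (simp add: flux_def matrix_matrix_mult_def del: Ck_on.simps)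
qed

text \<open>Cramer's rule gives differentiability of the inverse; the value of the derivative then
  follows by differentiating the identity \<open>gram_mult_inv\<close> along the path and
  solving.\<close>

lemma has_vector_derivative_inv_gram:
  fixes P :: "real \<Rightarrow> real^'n^'m"
  assumes P: "\<And>a i. Ck_on (Suc 0) UNIV (\<lambda>t. P t $ a $ i)"
    and G: "((\<lambda>t. gram (P t)) has_vector_derivative G') (at t)"
  defines "K \<equiv> matrix_inv (gram (P t))"
  shows "((\<lambda>t. matrix_inv (gram (P t))) has_vector_derivative - (K ** G' ** K)) (at t)"
proof -
  let ?K = "\<lambda>t. matrix_inv (gram (P t))"
  define K' where "K' = (\<chi> i j. vector_derivative (\<lambda>t. ?K t $ i $ j) (at t))"
  have "(\<lambda>t. ?K t $ i $ j) differentiable (at t)" for i j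
    using C1_has_derivative[OF C1_matrix_inv[OF open_UNIV gram_entry_C1[OF P]], of t i j]
      det_gram_pos by (metis UNIV_I differentiable_def less_irrefl)
  then have K': "(?K has_vector_derivative K') (at t)"
    by (intro has_vector_derivative_matrix) (simp add: K'_def vector_derivative_works[symmetric])
  have "((\<lambda>t. gram (P t) ** ?K t) has_vector_derivative gram (P t) ** K' + G' ** ?K t) (at t)"
    using bounded_bilinear.has_vector_derivative[OF bounded_bilinear_matrix_mult G K'] .
  then have "gram (P t) ** K' + G' ** ?K t = 0"
    by (metis (no_types, lifting) gram_mult_inv has_vector_derivative_const
        has_vector_derivative_transform_within_open open_UNIV UNIV_I vector_derivative_unique_at)
  then have eq: "gram (P t) ** K' = - (G' ** K)"
    by (simp add: K_def eq_neg_iff_add_eq_0)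
  have "K' = K ** (gram (P t) ** K')"
    by (simp add: matrix_mul_assoc K_def inv_mult_gram)
  also have "\<dots> = - (K ** G' ** K)"
    by (simp add: eq matrix_minus_right matrix_mul_assoc)
  finally have "K' = - (K ** G' ** K)" .
  with K' show ?thesis by simp
qed

section \<open>The second derivative of the area integrand along a segment\<close>

text \<open>Expanding \<open>q\<close> gives four products, whose outer factors are moved onto
  \<open>c - d\<close> by the adjoint rules. The matrix \<open>d\<close> stays free because two
  instances are needed: the one of the second derivative, and \<open>d = 0\<close>, where the
  right-hand side is a sum of squares.\<close>

lemma flux_derivative_form:
  fixes p c d :: "real^'n^'m"
  defines "q \<equiv> (mat 1 + p ** transpose p) ** c ** gram p"
  shows "(c - d) \<bullet> q = (c - d) \<bullet> c
     + (transpose p ** c - transpose p ** d) \<bullet> (transpose p ** c)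
     + (c ** transpose p - d ** transpose p) \<bullet> (c ** transpose p)
     + (transpose p ** c ** transpose p - transpose p ** d ** transpose p) \<bullet>
       (transpose p ** c ** transpose p)"
proof -
  have "q = c + p ** (transpose p ** c) + c ** transpose p ** p +
      p ** (transpose p ** c ** transpose p) ** p"
    by (simp add: q_def gram_def matrix_add_ldistrib matrix_add_rdistrib matrix_mul_assoc)
  then show ?thesis
    by (simp only: inner_add_right inner_mult_eq_transpose_left[of _ p]
        inner_mult_eq_transpose_right[of _ _ p]
        matrix_diff_ldistrib matrix_diff_rdistrib)
       (simp only: matrix_mul_assoc)
qed

text \<open>Each of the four summands has the form \<open>(y - x) \<bullet> y\<close>, and
  \<open>norm x \<le> norm y\<close> since multiplying by a contraction does not increase the
  Frobenius norm. If the sum vanishes, so does its first summand, and the equality case applies to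
  it.\<close>

lemma flux_derivative_form_nonneg:
  fixes p c :: "real^'n^'m"
  assumes "contraction p"
  defines "d \<equiv> p ** transpose c ** p"
    and "q \<equiv> (mat 1 + p ** transpose p) ** c ** gram p"
  shows "0 \<le> (c - d) \<bullet> q" and "(c - d) \<bullet> q = 0 \<Longrightarrow> d = c"
proof -
  note L = contraction_mult_left[OF assms(1)] and Lt = contraction_mult_left_transpose[OF assms(1)]
    and R = contraction_mult_right[OF assms(1)] and Rt = contraction_mult_right_transpose[OF assms(1)]
  \<comment> \<open>The terms with \<open>d\<close> contain \<open>transpose c\<close>, so their
    comparison with \<open>c\<close> passes through transposed products of the same norm.\<close>
  have tr: "norm (transpose c ** p) = norm (transpose p ** c)"
    "norm (p ** transpose c) = norm (c ** transpose p)"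
    "norm (p ** transpose c ** p) = norm (transpose p ** c ** transpose p)"
    using norm_transpose[of "transpose c ** p"] norm_transpose[of "p ** transpose c"]
      norm_transpose[of "p ** transpose c ** p"]
    by (simp_all add: matrix_transpose_mul matrix_mul_assoc)
  have 1: "norm d \<le> norm c"
    unfolding d_def using L[of "transpose c"] R[of "p ** transpose c"] by (simp add: norm_transpose)
  have 2: "norm (transpose p ** d) \<le> norm (transpose p ** c)"
    unfolding d_def tr(1)[symmetric]
    using Lt[of "p ** (transpose c ** p)"] L[of "transpose c ** p"] by (simp add: matrix_mul_assoc)
  have 3: "norm (d ** transpose p) \<le> norm (c ** transpose p)"
    unfolding d_def tr(2)[symmetric]
    using Rt[of "p ** transpose c ** p"] R[of "p ** transpose c"] by simp
  have 4: "norm (transpose p ** d ** transpose p) \<le> norm (transpose p ** c ** transpose p)"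
    unfolding d_def tr(3)[symmetric]
    using Lt[of "p ** transpose c ** p ** transpose p"] Rt[of "p ** transpose c ** p"]
    by (simp add: matrix_mul_assoc)
  note nonneg = norm_le_inner_diff_nonneg[OF 1] norm_le_inner_diff_nonneg[OF 2]
    norm_le_inner_diff_nonneg[OF 3] norm_le_inner_diff_nonneg[OF 4]
  have eq: "(c - d) \<bullet> q = (c - d) \<bullet> c
     + (transpose p ** c - transpose p ** d) \<bullet> (transpose p ** c)
     + (c ** transpose p - d ** transpose p) \<bullet> (c ** transpose p)
     + (transpose p ** c ** transpose p - transpose p ** d ** transpose p) \<bullet>
       (transpose p ** c ** transpose p)"
    unfolding q_def by (rule flux_derivative_form)
  show "0 \<le> (c - d) \<bullet> q"
    unfolding eq using nonneg by linarith
  show "d = c" if "(c - d) \<bullet> q = 0"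
    by (rule norm_le_inner_diff_zero[OF 1]) (use that nonneg in \<open>unfold eq, linarith\<close>)
qed

text \<open>In \<open>c\<close>, the factor \<open>mat 1 - r ** H ** transpose r\<close> is the
  inverse of \<open>mat 1 + r ** transpose r\<close>. Differentiating the root of the determinant
  produces the square; differentiating \<open>r ** H\<close> produces the remaining form in
  \<open>c\<close>.\<close>

lemma flux_derivative:
  fixes p q :: "real^'n^'m" and t :: real
  defines "r \<equiv> p + t *\<^sub>R q"
  defines "H \<equiv> matrix_inv (gram r)"
  defines "c \<equiv> (mat 1 - r ** H ** transpose r) ** q ** H"
  shows "((\<lambda>s. flux (p + s *\<^sub>R q) \<bullet> q) has_real_derivative
      sqrt (det (gram r)) * (((r ** H) \<bullet> q)\<^sup>2 + (c - r ** transpose c ** r) \<bullet> q)) (at t)"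
    and "q = (mat 1 + r ** transpose r) ** c ** gram r"
proof -
  have HG: "H ** gram r = mat 1" and GH: "gram r ** H = mat 1" and HT: "transpose H = H"
    by (simp_all add: H_def inv_mult_gram gram_mult_inv transpose_inv_gram)
  define G' where "G' = transpose q ** r + transpose r ** q"
  define P where "P s = p + s *\<^sub>R q" for s
  have Pt: "P t = r" by (simp add: P_def r_def)
  have P: "(P has_vector_derivative q) (at t)"
    unfolding P_def by (auto intro!: derivative_eq_intros simp: has_vector_derivative_def)
  have P_C1: "Ck_on (Suc 0) UNIV (\<lambda>s. P s $ a $ i)" for a i
    using C1_add[OF C1_const C1_linear[OF bounded_linear_mult_left]]
    by (simp add: P_def del: Ck_on.simps)
  have PT: "((\<lambda>s. transpose (P s)) has_vector_derivative transpose q) (at t)"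
    using bounded_linear.has_vector_derivative[of transpose, OF _ P]
    by (simp add: linear_conv_bounded_linear[symmetric] linear_iff transpose_add transpose_scalar)
  have "((\<lambda>s. transpose (P s) ** P s) has_vector_derivative transpose r ** q + transpose q ** r) (at t)"
    using bounded_bilinear.has_vector_derivative[OF bounded_bilinear_matrix_mult PT P] by (simp add: Pt)
  then have G: "((\<lambda>s. gram (P s)) has_vector_derivative G') (at t)"
    unfolding gram_def G'_def by (auto intro!: derivative_eq_intros simp: add.commute)
  have "((\<lambda>s. matrix_inv (gram (P s))) has_vector_derivative - (H ** G' ** H)) (at t)"
    using has_vector_derivative_inv_gram[OF P_C1 G] by (simp add: Pt H_def)
  from bounded_bilinear.has_vector_derivative[OF bounded_bilinear_matrix_mult P this]
  have "((\<lambda>s. P s ** matrix_inv (gram (P s))) has_vector_derivative q ** H - r ** H ** G' ** H) (at t)"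
    by (simp add: Pt matrix_minus_right matrix_mul_assoc flip: H_def)
  then have PH: "((\<lambda>s. (P s ** matrix_inv (gram (P s))) \<bullet> q) has_real_derivative
      (q ** H - r ** H ** G' ** H) \<bullet> q) (at t)"
    using bounded_linear.has_vector_derivative[OF bounded_linear_inner_left]
    by (simp add: has_real_derivative_iff_has_vector_derivative)
  \<comment> \<open>Both halves of \<open>G'\<close> contribute equally because \<open>H\<close> is
    symmetric.\<close>
  have tr: "trace (H ** G') = 2 * ((r ** H) \<bullet> q)"
  proof -
    have "H \<bullet> (transpose q ** r) = transpose H \<bullet> transpose (transpose q ** r)"
      by (simp only: inner_transpose)
    also have "\<dots> = (r ** H) \<bullet> q"
      by (simp add: HT matrix_transpose_mul inner_mult_eq_transpose_left)
    finally show ?thesis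
      by (simp add: trace_matrix_mult HT G'_def inner_add_right inner_mult_eq_transpose_left)
  qed
  have "((\<lambda>s. det (gram (P s))) has_real_derivative det (gram r) * trace (H ** G')) (at t)"
    using has_real_derivative_det[OF G, of H] by (simp add: Pt HG)
  from DERIV_chain2[OF DERIV_real_sqrt this, unfolded Pt, OF det_gram_pos]
  have F: "((\<lambda>s. sqrt (det (gram (P s)))) has_real_derivative
      sqrt (det (gram r)) * ((r ** H) \<bullet> q)) (at t)"
  proof (rule DERIV_cong)
    have "det (gram r) = sqrt (det (gram r)) * sqrt (det (gram r))"
      using det_gram_pos[of r] by simp
    then show "inverse (sqrt (det (gram r))) / 2 * (det (gram r) * trace (H ** G')) =
        sqrt (det (gram r)) * ((r ** H) \<bullet> q)"
      using det_gram_pos[of r] by (simp add: tr field_simps)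
  qed
  \<comment> \<open>\<open>mat 1 + r ** transpose r\<close> times \<open>r\<close> is
    \<open>r ** gram r\<close>, and \<open>gram r\<close> cancels \<open>H\<close>.\<close>
  have KL: "(mat 1 + r ** transpose r) ** (mat 1 - r ** H ** transpose r) = mat 1"
  proof -
    have "(mat 1 + r ** transpose r) ** (r ** H ** transpose r) = r ** (gram r ** H) ** transpose r"
      by (simp add: gram_def matrix_add_rdistrib matrix_add_ldistrib matrix_mul_assoc)
    then show ?thesis
      by (simp add: GH matrix_diff_ldistrib)
  qed
  have Kr: "(mat 1 - r ** H ** transpose r) ** r = r ** H"
  proof -
    have "r ** H + r ** H ** transpose r ** r = r ** (H ** gram r)"
      by (simp add: gram_def matrix_add_ldistrib matrix_mul_assoc)
    then show ?thesis
      by (simp add: HG matrix_diff_rdistrib algebra_simps)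
  qed
  show "q = (mat 1 + r ** transpose r) ** c ** gram r"
  proof -
    have "(mat 1 + r ** transpose r) ** c ** gram r =
       ((mat 1 + r ** transpose r) ** (mat 1 - r ** H ** transpose r)) ** q ** (H ** gram r)"
      by (simp only: c_def matrix_mul_assoc)
    then show ?thesis by (simp add: KL HG)
  qed
  \<comment> \<open>Symmetry of this inverse and \<open>Kr\<close> turn
    \<open>r ** transpose c ** r\<close> into a term of the differentiated
    \<open>r ** H\<close>.\<close>
  have "transpose (mat 1 - r ** H ** transpose r) = mat 1 - r ** H ** transpose r"
    using transpose_add[of "mat 1 - r ** H ** transpose r" "r ** H ** transpose r"]
    by (simp add: matrix_transpose_mul HT matrix_mul_assoc algebra_simps)
  then have "r ** transpose c ** r = r ** H ** transpose q ** ((mat 1 - r ** H ** transpose r) ** r)"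
    by (simp only: c_def matrix_transpose_mul HT matrix_mul_assoc)
  then have d: "r ** transpose c ** r = r ** H ** transpose q ** r ** H"
    by (simp only: Kr matrix_mul_assoc)
  have cd: "q ** H - r ** H ** G' ** H = c - r ** transpose c ** r"
    unfolding d unfolding c_def G'_def
    by (simp add: matrix_diff_rdistrib matrix_add_ldistrib matrix_add_rdistrib matrix_mul_assoc)
  from DERIV_mult[OF F PH]
  show "((\<lambda>s. flux (p + s *\<^sub>R q) \<bullet> q) has_real_derivative
      sqrt (det (gram r)) * (((r ** H) \<bullet> q)\<^sup>2 + (c - r ** transpose c ** r) \<bullet> q)) (at t)"
    unfolding flux_def P_def[symmetric]
    by (simp add: cd Pt power2_eq_square algebra_simps flip: H_def)
qed

lemma flux_strict_mono:
  fixes p q :: "real^'n^'m"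
  assumes p: "contraction p" and pq: "contraction (p + q)"
  shows "0 \<le> (flux (p + q) - flux p) \<bullet> q"
    and "(flux (p + q) - flux p) \<bullet> q = 0 \<Longrightarrow> q = 0"
proof -
  define r where "r t = p + t *\<^sub>R q" for t :: real
  define H where "H t = matrix_inv (gram (r t))" for t
  define c where "c t = (mat 1 - r t ** H t ** transpose (r t)) ** q ** H t" for t
  define d where "d t = r t ** transpose (c t) ** r t" for t
  define \<phi>' where "\<phi>' t = sqrt (det (gram (r t))) * (((r t ** H t) \<bullet> q)\<^sup>2 + (c t - d t) \<bullet> q)" for t
  let ?\<phi> = "\<lambda>t. flux (r t) \<bullet> q"
  have q: "q = (mat 1 + r t ** transpose (r t)) ** c t ** gram (r t)" for t
    unfolding c_def H_def r_def by (rule flux_derivative)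
  have D: "(?\<phi> has_real_derivative \<phi>' t) (at t)" for t
    unfolding \<phi>'_def d_def c_def H_def r_def by (rule flux_derivative)
  have r: "contraction (r t)" if "0 \<le> t" "t \<le> 1" for t
    unfolding r_def using contraction_convex[OF p pq that] .
  have form: "0 \<le> (c t - d t) \<bullet> q" "(c t - d t) \<bullet> q = 0 \<Longrightarrow> d t = c t" if "0 \<le> t" "t \<le> 1" for t
    using flux_derivative_form_nonneg[OF r[OF that], of "c t"] unfolding d_def q[of t, symmetric] .
  have mono: "?\<phi> s \<le> ?\<phi> t" if "0 \<le> s" "s \<le> t" "t \<le> 1" for s t
  proof (rule DERIV_nonneg_imp_nondecreasing[OF that(2)])
    fix x assume "s \<le> x" "x \<le> t"
    then have "0 \<le> x" "x \<le> 1" using that by auto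
    then have "0 \<le> \<phi>' x"
      unfolding \<phi>'_def using det_gram_pos[of "r x"] form(1)[of x]
      by (intro mult_nonneg_nonneg add_nonneg_nonneg) simp_all
    then show "\<exists>y. (?\<phi> has_real_derivative y) (at x) \<and> 0 \<le> y"
      using D by blast
  qed
  show "0 \<le> (flux (p + q) - flux p) \<bullet> q"
    using mono[of 0 1] by (simp add: r_def inner_diff_left)
  assume "(flux (p + q) - flux p) \<bullet> q = 0"
  \<comment> \<open>A nondecreasing function with equal end values is constant. Its derivative then
    vanishes at the midpoint, about which \<open>p\<close> and \<open>p + q\<close> lie
    symmetrically.\<close>
  then have const: "?\<phi> t = ?\<phi> 0" if "0 \<le> t" "t \<le> 1" for t
    using mono[of 0 t] mono[of t 1] that by (simp add: r_def inner_diff_left)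
  have "((\<lambda>_. ?\<phi> 0) has_real_derivative \<phi>' (1/2)) (at (1/2))"
  proof (rule has_field_derivative_transform_within_open[OF D, where S = "{0<..<1}"])
    fix t :: real assume "t \<in> {0<..<1}"
    then show "?\<phi> t = ?\<phi> 0"
      by (intro const) auto
  qed auto
  then have "\<phi>' (1/2) = 0"
    using DERIV_unique DERIV_const by blast
  then have "(c (1/2) - d (1/2)) \<bullet> q = 0"
    using det_gram_pos[of "r (1/2)"] form(1)[of "1/2"] by (simp add: \<phi>'_def add_nonneg_eq_0_iff)
  then have dc: "d (1/2) = c (1/2)"
    using form(2)[of "1/2"] by simp
  define C where "C = c (1/2)"
  define R where "R = r (1/2)"
  have R: "contraction R" unfolding R_def by (rule r) auto
  have C: "C = R ** transpose C ** R" using dc by (simp add: d_def C_def R_def)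
  \<comment> \<open>The identity for \<open>C\<close> reverses the contraction estimate: the rows of
    \<open>C\<close> lose no length under \<open>R\<close>.\<close>
  have "norm C \<le> norm (R ** transpose C)"
    by (subst C) (rule contraction_mult_right[OF R])
  also have "\<dots> = norm (C ** transpose R)"
    by (metis matrix_transpose_mul norm_transpose transpose_transpose)
  finally have 1: "(norm C)\<^sup>2 \<le> (norm (C ** transpose R))\<^sup>2" by simp
  have ends: "C ** transpose p = C ** transpose R - (1/2) *\<^sub>R (C ** transpose q)"
    "C ** transpose (p + q) = C ** transpose R + (1/2) *\<^sub>R (C ** transpose q)"
  proof -
    have "(1/2) *\<^sub>R q + (1/2) *\<^sub>R q = q"
      by (simp flip: scaleR_add_left)
    then have "p + q = R + (1/2) *\<^sub>R q" and "p = R - (1/2) *\<^sub>R q"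
      by (simp_all add: R_def r_def algebra_simps)
    then show "C ** transpose p = C ** transpose R - (1/2) *\<^sub>R (C ** transpose q)"
      "C ** transpose (p + q) = C ** transpose R + (1/2) *\<^sub>R (C ** transpose q)"
      by (simp_all only: transpose_add transpose_diff transpose_scalar matrix_add_ldistrib
          matrix_diff_ldistrib matrix_scalar_ac scalar_matrix_assoc)
  qed
  have 2: "(norm (C ** transpose p))\<^sup>2 \<le> (norm C)\<^sup>2" "(norm (C ** transpose (p + q)))\<^sup>2 \<le> (norm C)\<^sup>2"
    using contraction_mult_right_transpose[OF p] contraction_mult_right_transpose[OF pq]
    by (auto intro: power_mono)
  \<comment> \<open>Parallelogram identity: both end products have norm at most that of
    \<open>C\<close>, which is at most that of their midpoint \<open>C ** transpose R\<close>; so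
    their half difference is 0.\<close>
  have "(norm (C ** transpose q))\<^sup>2 \<le> 0"
    using 1 2 unfolding ends power2_norm_eq_inner
    by (simp add: inner_diff_left inner_diff_right inner_add_left inner_add_right inner_commute)
  then have "C ** transpose q = 0" by simp
  \<comment> \<open>\<open>C \<bullet> q\<close> is the trace of \<open>C ** transpose q\<close>,
    while the instance \<open>d = 0\<close> of the form bounds it below by
    \<open>C \<bullet> C\<close>.\<close>
  then have "C \<bullet> q = 0"
    using inner_mult_eq_transpose_right[of C "mat 1" q] by simp
  moreover have "C \<bullet> C \<le> C \<bullet> q"
    using flux_derivative_form[of C 0 R] q[of "1/2"] by (simp add: C_def R_def)
  ultimately have "C = 0"
    using inner_gt_zero_iff[of C] by linarith
  then show "q = 0"
    using q[of "1/2"] by (simp add: C_def)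
qed

subsection \<open>Integration by parts against truncations\<close>

lemma DERIV_along_line:
  fixes w :: "'a::euclidean_space \<Rightarrow> real"
  assumes "(w has_derivative w') (at (x + t *\<^sub>R v))"
  shows "((\<lambda>s. w (x + s *\<^sub>R v)) has_real_derivative w' v) (at t)"
proof -
  have "((\<lambda>s. x + s *\<^sub>R v) has_derivative (\<lambda>s. s *\<^sub>R v)) (at t)"
    by (auto intro!: derivative_eq_intros)
  from has_derivative_compose[OF this assms]
  have "((\<lambda>s. w (x + s *\<^sub>R v)) has_derivative (\<lambda>s. w' (s *\<^sub>R v))) (at t)" .
  moreover have "(\<lambda>s. w' (s *\<^sub>R v)) = (*) (w' v)"
    using linear_scale[OF has_derivative_linear[OF assms]] by (simp add: fun_eq_iff)
  ultimately show ?thesis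
    by (simp add: has_field_derivative_def)
qed

lemma frechet_derivative_eq_0:
  assumes "open S" "x \<in> S" "\<And>y. y \<in> S \<Longrightarrow> w y = 0"
  shows "frechet_derivative w (at x) = (\<lambda>_. 0)"
proof -
  have "((\<lambda>_. 0) has_derivative (\<lambda>_. 0)) (at x)" by simp
  then have "(w has_derivative (\<lambda>_. 0)) (at x)"
    by (rule has_derivative_transform_within_open[OF _ assms(1,2)]) (simp add: assms(3))
  from frechet_derivative_at[OF this] show ?thesis by simp
qed

lemma continuous_compact_support_integrable:
  fixes w :: "'a::euclidean_space \<Rightarrow> real"
  assumes "continuous_on UNIV w" "compact K" "\<And>x. x \<notin> K \<Longrightarrow> w x = 0"
  shows "integrable lborel w"
proof -
  have "integrable lborel (\<lambda>x. indicator K x *\<^sub>R w x)"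
    using assms(1,2) by (intro borel_integrable_compact) (auto intro: continuous_on_subset)
  moreover have "(\<lambda>x. indicator K x *\<^sub>R w x) = w"
    using assms(3) by (auto simp: fun_eq_iff indicator_def)
  ultimately show ?thesis by simp
qed

lemma integral_translation:
  fixes w :: "'a::euclidean_space \<Rightarrow> real"
  assumes "integrable lborel w"
  shows "integrable lborel (\<lambda>x. w (x + c))"
    and "integral\<^sup>L lborel (\<lambda>x. w (x + c)) = integral\<^sup>L lborel w"
proof -
  have m: "(+) c \<in> measurable lborel borel" by simp
  have w: "w \<in> borel_measurable borel"
    using assms by (simp add: integrable_iff_bounded)
  show "integrable lborel (\<lambda>x. w (x + c))"
    using integrable_distr[OF m, of w, unfolded lborel_distr_plus, OF assms]
    by (simp add: add.commute)
  show "integral\<^sup>L lborel (\<lambda>x. w (x + c)) = integral\<^sup>L lborel w"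
    using integral_distr[OF m w, unfolded lborel_distr_plus] by (simp add: add.commute)
qed

text \<open>By translation invariance all difference quotients of \<open>w\<close> have integral 0.\<close>

lemma integral_derivative_compact_support:
  fixes w :: "'a::euclidean_space \<Rightarrow> real" and v :: 'a
  assumes w: "Ck_on (Suc 0) UNIV w" and K: "compact K" and supp: "\<And>x. x \<notin> K \<Longrightarrow> w x = 0"
  defines "D \<equiv> \<lambda>x. frechet_derivative w (at x) v"
  shows "integrable lborel D" and "integral\<^sup>L lborel D = 0"
proof -
  have contD: "continuous_on UNIV D"
    unfolding D_def by (rule C1_continuous_derivative[OF w])
  have suppD: "D x = 0" if "x \<notin> K" for x
    using frechet_derivative_eq_0[of "- K" x w] K that supp
    by (simp add: D_def compact_imp_closed open_Compl)
  show int: "integrable lborel D"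
    by (rule continuous_compact_support_integrable[OF contD K suppD])
  have intw: "integrable lborel w"
    by (rule continuous_compact_support_integrable[OF C1_continuous[OF w] K supp])
  have "compact (D ` K)"
    using K contD by (intro compact_continuous_image) (auto intro: continuous_on_subset)
  then obtain B where "\<forall>y \<in> D ` K. norm y \<le> B"
    using compact_imp_bounded bounded_iff by metis
  \<comment> \<open>The maximum with 0 keeps the bound valid if \<open>K\<close> is empty.\<close>
  then have B: "\<bar>D x\<bar> \<le> max B 0" for x
    using suppD[of x] by (cases "x \<in> K") force+
  obtain r where r: "\<And>x. x \<in> K \<Longrightarrow> norm x \<le> r"
    using compact_imp_bounded[OF K] by (auto simp: bounded_iff)
  define h where "h n = inverse (real (Suc n))" for n
  have h: "0 < h n" "h n \<le> 1" for n
    unfolding h_def by (auto simp: field_simps)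
  define s where "s n x = (w (x + h n *\<^sub>R v) - w x) / h n" for n x
  have line: "((\<lambda>t. w (x + t *\<^sub>R v)) has_real_derivative D (x + t *\<^sub>R v)) (at t)" for x t
    unfolding D_def by (rule DERIV_along_line[OF C1_has_derivative[OF w UNIV_I]])
  have lim: "(\<lambda>n. s n x) \<longlonglongrightarrow> D x" for x
  proof -
    have "((\<lambda>t. (w (x + t *\<^sub>R v) - w x) / t) \<longlongrightarrow> D x) (at 0)"
      using line[of x 0] by (simp add: DERIV_def)
    moreover have "filterlim h (at 0) sequentially"
      unfolding filterlim_at h_def using LIMSEQ_inverse_real_of_nat by auto
    ultimately show ?thesis
      unfolding s_def by (rule filterlim_compose)
  qed
  \<comment> \<open>A dominating function for the quotients: since \<open>h n \<le> 1\<close>, both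
    arguments of \<open>w\<close> avoid \<open>K\<close> outside the enlarged ball, and inside it
    the mean value theorem reduces the quotient to a value of \<open>D\<close>.\<close>
  have bound: "norm (s n x) \<le> indicator (cball 0 (r + norm v)) x * max B 0" for n x
  proof (cases "x \<in> cball 0 (r + norm v)")
    case True
    obtain z where "w (x + h n *\<^sub>R v) - w (x + 0 *\<^sub>R v) = (h n - 0) * D (x + z *\<^sub>R v)"
      using MVT2[OF h(1)[of n] line[of x]] by blast
    then have "s n x = D (x + z *\<^sub>R v)"
      using h(1)[of n] by (simp add: s_def)
    then show ?thesis using B True by simp
  next
    case False
    have "norm (h n *\<^sub>R v) \<le> norm v"
      using h[of n] by (simp add: mult_left_le_one_le)
    moreover have "norm x \<le> norm (x + h n *\<^sub>R v) + norm (h n *\<^sub>R v)"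
      using norm_triangle_ineq4[of "x + h n *\<^sub>R v" "h n *\<^sub>R v"] by simp
    moreover have "r + norm v < norm x" using False by simp
    ultimately have "r < norm (x + h n *\<^sub>R v)" "r < norm x"
      using norm_ge_zero[of v] by linarith+
    then have "x + h n *\<^sub>R v \<notin> K" "x \<notin> K"
      using r by fastforce+
    then show ?thesis
      using supp by (simp add: s_def)
  qed
  have s0: "integral\<^sup>L lborel (s n) = 0" and sm: "s n \<in> borel_measurable lborel" for n
  proof -
    have "integrable lborel (s n)"
      unfolding s_def by (intro integrable_divide Bochner_Integration.integrable_diff integral_translation intw)
    then show "s n \<in> borel_measurable lborel" by auto
    show "integral\<^sup>L lborel (s n) = 0"
      unfolding s_def using integral_translation[OF intw, of "h n *\<^sub>R v"] intw by simp
  qed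
  have "integrable lborel (\<lambda>x::'a. indicator (cball 0 (r + norm v)) x * max B 0)"
    using borel_integrable_compact[of "cball (0::'a) (r + norm v)" "\<lambda>_. max B 0"] by simp
  from integral_dominated_convergence[OF _ sm this, of D]
  have "(\<lambda>n. integral\<^sup>L lborel (s n)) \<longlonglongrightarrow> integral\<^sup>L lborel D"
    using int lim bound by auto
  then show "integral\<^sup>L lborel D = 0"
    by (simp add: s0 LIMSEQ_const_iff)
qed

text \<open>Since \<open>u\<close> vanishes on the frontier, \<open>\<psi> (u x)\<close> is 0 near
  it; the products \<open>\<psi> (u x) * a i x\<close>, extended by 0, have compact support and
  their derivatives integrate to 0. In the sum over \<open>i\<close> the divergence of
  \<open>a\<close> drops out and only the derivative of the truncation remains.\<close>

lemma divergence_free_truncation: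
  fixes \<Omega> :: "(real^'n) set" and u :: "real^'n \<Rightarrow> real" and a :: "'n \<Rightarrow> real^'n \<Rightarrow> real"
  assumes \<Omega>: "open \<Omega>" "bounded \<Omega>"
    and u: "Ck_on (Suc 0) \<Omega> u" "continuous_on (closure \<Omega>) u" "\<And>x. x \<in> frontier \<Omega> \<Longrightarrow> u x = 0"
    and a: "\<And>i. Ck_on (Suc 0) \<Omega> (a i)" "\<And>x. x \<in> \<Omega> \<Longrightarrow> (\<Sum>i\<in>UNIV. partial_deriv i (a i) x) = 0"
    and \<psi>: "\<And>s. (\<psi> has_real_derivative \<psi>' s) (at s)" "continuous_on UNIV \<psi>'"
      "0 < \<epsilon>" "\<And>s. \<bar>s\<bar> < \<epsilon> \<Longrightarrow> \<psi> s = 0"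
  shows "integral\<^sup>L lborel (\<lambda>x. indicator \<Omega> x * (\<psi>' (u x) * (\<Sum>i\<in>UNIV. partial_deriv i u x * a i x))) = 0"
proof -
  define w where "w i x = (if x \<in> \<Omega> then \<psi> (u x) * a i x else 0)" for i x
  define K where "K = closure \<Omega> \<inter> u -` {s. \<epsilon> \<le> \<bar>s\<bar>}"
  have "closed {s::real. \<epsilon> \<le> \<bar>s\<bar>}"
    by (intro closed_Collect_le continuous_intros)
  then have closedK: "closed K"
    unfolding K_def by (rule continuous_closed_preimage[OF u(2) closed_closure])
  have K: "compact K"
    unfolding compact_eq_bounded_closed using closedK \<Omega>(2)
    by (auto simp: K_def intro: bounded_subset[OF bounded_closure])
  have K\<Omega>: "K \<subseteq> \<Omega>"
    using u(3) \<psi>(3) closure_Un_frontier[of \<Omega>] by (force simp: K_def)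
  have w0: "w i x = 0" if "x \<notin> K" for i x
    using that \<psi>(4)[of "u x"] closure_subset[of \<Omega>] by (auto simp: w_def K_def)
  have \<psi>u: "Ck_on (Suc 0) \<Omega> (\<lambda>x. \<psi> (u x))"
    by (rule C1_chain[OF u(1) \<psi>(1)]) (use \<psi>(2) in \<open>auto intro: continuous_on_subset\<close>)
  \<comment> \<open>On \<open>\<Omega>\<close> the function is a product of continuously
    differentiable ones, off \<open>K\<close> it is 0, and these two open sets cover the
    space.\<close>
  have wC1: "Ck_on (Suc 0) UNIV (w i)" for i
  proof -
    have "Ck_on (Suc 0) \<Omega> (w i)"
      by (rule C1_cong[OF \<Omega>(1) C1_mult[OF \<psi>u a(1)[of i]]]) (simp add: w_def)
    moreover have "Ck_on (Suc 0) (- K) (w i)"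
      by (rule C1_cong[OF _ C1_const[of _ 0]]) (use closedK w0 in auto)
    moreover have "\<Omega> \<union> - K = UNIV" using K\<Omega> by auto
    ultimately show ?thesis
      using C1_Un[OF \<Omega>(1), of "- K" "w i"] closedK by (simp add: open_Compl del: Ck_on.simps)
  qed
  have D: "frechet_derivative (w i) (at x) (axis i 1) =
      indicator \<Omega> x * (\<psi>' (u x) * (partial_deriv i u x * a i x) + \<psi> (u x) * partial_deriv i (a i) x)" for i x
  proof (cases "x \<in> \<Omega>")
    case True
    let ?Du = "frechet_derivative u (at x)" and ?Da = "frechet_derivative (a i) (at x)"
    have "((\<lambda>x. \<psi> (u x)) has_derivative (\<lambda>v. \<psi>' (u x) * ?Du v)) (at x)"
      using has_derivative_compose[OF C1_has_derivative[OF u(1) True] \<psi>(1)[unfolded has_field_derivative_def]] .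
    from has_derivative_mult[OF this C1_has_derivative[OF a(1) True]]
    have "((\<lambda>x. \<psi> (u x) * a i x) has_derivative
        (\<lambda>v. \<psi> (u x) * ?Da v + \<psi>' (u x) * ?Du v * a i x)) (at x)" .
    then have "(w i has_derivative (\<lambda>v. \<psi> (u x) * ?Da v + \<psi>' (u x) * ?Du v * a i x)) (at x)"
      by (rule has_derivative_transform_within_open[OF _ \<Omega>(1) True]) (simp add: w_def)
    from frechet_derivative_at[OF this, symmetric] show ?thesis
      using True by (simp add: partial_deriv_def algebra_simps)
  next
    case False
    then have "x \<in> - K" using K\<Omega> by auto
    then show ?thesis
      using frechet_derivative_eq_0[of "- K" x "w i"] closedK w0 False by (simp add: open_Compl)
  qed
  have "0 = (\<Sum>i\<in>UNIV. integral\<^sup>L lborel (\<lambda>x. frechet_derivative (w i) (at x) (axis i 1)))"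
    using integral_derivative_compact_support(2)[OF wC1 K w0] by simp
  also have "\<dots> = integral\<^sup>L lborel (\<lambda>x. \<Sum>i\<in>UNIV. frechet_derivative (w i) (at x) (axis i 1))"
    using integral_derivative_compact_support(1)[OF wC1 K w0]
    by (intro Bochner_Integration.integral_sum[symmetric])
  also have "(\<lambda>x. \<Sum>i\<in>UNIV. frechet_derivative (w i) (at x) (axis i 1)) =
     (\<lambda>x. indicator \<Omega> x * (\<psi>' (u x) * (\<Sum>i\<in>UNIV. partial_deriv i u x * a i x)))"
  proof
    fix x
    show "(\<Sum>i\<in>UNIV. frechet_derivative (w i) (at x) (axis i 1)) =
      indicator \<Omega> x * (\<psi>' (u x) * (\<Sum>i\<in>UNIV. partial_deriv i u x * a i x))"
      unfolding D using a(2)[of x]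
      by (cases "x \<in> \<Omega>") (simp_all add: sum.distrib flip: sum_distrib_left)
  qed
  finally show ?thesis by simp
qed

section \<open>Zeros with nonvanishing derivative\<close>

text \<open>Near such a zero \<open>x0\<close>, fix \<open>v\<close> on which the derivative is
  positive. Seen from \<open>x0 - v\<close>, every ray that meets a small ball about
  \<open>x0\<close> runs almost in direction \<open>v\<close>, so \<open>u\<close> is strictly
  increasing on it there and vanishes at most once. Closed sets with this property are
  negligible.\<close>

lemma negligible_regular_zero_set:
  fixes u :: "'a::euclidean_space \<Rightarrow> real"
  assumes \<Omega>: "open \<Omega>" and u: "Ck_on (Suc 0) \<Omega> u"
  shows "negligible {x \<in> \<Omega>. u x = 0 \<and> frechet_derivative u (at x) \<noteq> (\<lambda>_. 0)}" (is "negligible ?Z")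
proof (rule iffD2[OF locally_negligible_alt], rule ballI)
  let ?D = "\<lambda>x. frechet_derivative u (at x)"
  fix x0 assume x0: "x0 \<in> ?Z"
  have lin: "linear (?D x)" if "x \<in> \<Omega>" for x
    using C1_has_derivative[OF u that] has_derivative_linear by blast
  obtain v0 where "?D x0 v0 \<noteq> 0" using x0 by auto
  then obtain v where v: "?D x0 v > 0"
    using linear_neg[OF lin, of x0 v0] x0 by (metis (no_types, lifting) linorder_neqE_linordered_idom mem_Collect_eq neg_0_less_iff_less)
  \<comment> \<open>An upper bound for the operator norm of the derivative that is visibly
    continuous.\<close>
  define g where "g x = (\<Sum>b\<in>Basis. \<bar>?D x b\<bar>)" for x
  define \<eta> where "\<eta> = ?D x0 v / 2"
  define B where "B = g x0 + 1"
  have Dbound: "\<bar>?D x y\<bar> \<le> norm y * g x" if "x \<in> \<Omega>" for x y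
  proof -
    have "?D x y = ?D x (\<Sum>b\<in>Basis. (y \<bullet> b) *\<^sub>R b)"
      by (simp add: euclidean_representation)
    also have "\<dots> = (\<Sum>b\<in>Basis. (y \<bullet> b) * ?D x b)"
      by (simp add: linear_sum[OF lin[OF that]] linear_scale[OF lin[OF that]])
    also have "\<bar>\<dots>\<bar> \<le> (\<Sum>b\<in>Basis. \<bar>(y \<bullet> b) * ?D x b\<bar>)" by (rule sum_abs)
    also have "\<dots> \<le> (\<Sum>b\<in>Basis. norm y * \<bar>?D x b\<bar>)"
      by (intro sum_mono) (simp add: abs_mult Basis_le_norm mult_right_mono)
    finally show ?thesis by (simp add: g_def sum_distrib_left)
  qed
  have pos: "0 < \<eta>" "0 < B"
    using v sum_nonneg[of Basis "\<lambda>b. \<bar>?D x0 b\<bar>"] by (simp_all add: \<eta>_def B_def g_def add_nonneg_pos)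
  have gcont: "continuous_on \<Omega> g"
    unfolding g_def by (intro continuous_intros C1_continuous_derivative[OF u])
  define W where "W = (\<Omega> \<inter> (\<lambda>x. ?D x v) -` {\<eta><..}) \<inter> (\<Omega> \<inter> g -` {..<B})"
  have "open W"
    unfolding W_def by (intro open_Int continuous_open_preimage C1_continuous_derivative[OF u] gcont \<Omega>) auto
  moreover have "x0 \<in> W" using x0 v by (auto simp: W_def \<eta>_def B_def)
  ultimately obtain e where e: "0 < e" "cball x0 e \<subseteq> W"
    by (meson open_contains_cball)
  \<comment> \<open>With this radius, replacing \<open>v\<close> by a direction within
    \<open>r\<close> of it changes the derivative by at most \<open>r * B\<close>, which is less
    than \<open>\<eta>\<close>; \<open>e\<close> keeps the ball inside \<open>W\<close>.\<close>
  define r where "r = min e (\<eta> / (2 * B))"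
  have r: "0 < r" "r * B < \<eta>"
  proof -
    show "0 < r" using e pos by (simp add: r_def)
    have "r * B \<le> \<eta> / (2 * B) * B" using pos by (intro mult_right_mono) (auto simp: r_def)
    also have "\<dots> < \<eta>" using pos by simp
    finally show "r * B < \<eta>" .
  qed
  have rW: "cball x0 r \<subseteq> W" using e by (auto simp: r_def)
  define S where "S = {x \<in> cball x0 r. u x = 0}"
  have "closed S"
    unfolding S_def using rW
    by (intro continuous_closed_preimage_constant continuous_on_subset[OF C1_continuous[OF u]])
       (auto simp: W_def)
  have inj: False if "s < t" "(x0 - v) + s *\<^sub>R x \<in> S" "(x0 - v) + t *\<^sub>R x \<in> S" "norm (x - v) \<le> r"
    for s t :: real and x
  proof -
    have in_ball: "(x0 - v) + z *\<^sub>R x \<in> cball x0 r" if "s \<le> z" "z \<le> t" for z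
    proof -
      have "closed_segment ((x0 - v) + s *\<^sub>R x) ((x0 - v) + t *\<^sub>R x) \<subseteq> cball x0 r"
        using \<open>(x0 - v) + s *\<^sub>R x \<in> S\<close> \<open>(x0 - v) + t *\<^sub>R x \<in> S\<close>
        by (intro closed_segment_subset) (auto simp: S_def)
      moreover define l where "l = (z - s) / (t - s)"
      moreover have "(x0 - v) + z *\<^sub>R x =
          (1 - l) *\<^sub>R ((x0 - v) + s *\<^sub>R x) + l *\<^sub>R ((x0 - v) + t *\<^sub>R x)"
      proof -
        have "l * (t - s) = z - s"
          using \<open>s < t\<close> by (simp add: l_def)
        then have "z = (1 - l) * s + l * t" by (simp add: algebra_simps)
        then have "z *\<^sub>R x = ((1 - l) * s + l * t) *\<^sub>R x" by simp
        then show ?thesis by (simp add: algebra_simps)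
      qed
      moreover have "0 \<le> l" "l \<le> 1"
        using that \<open>s < t\<close> by (simp_all add: l_def)
      ultimately show ?thesis
        unfolding closed_segment_def by blast
    qed
    have der: "((\<lambda>z. u ((x0 - v) + z *\<^sub>R x)) has_real_derivative ?D ((x0 - v) + z *\<^sub>R x) x) (at z)"
      if "s \<le> z" "z \<le> t" for z
      by (rule DERIV_along_line[OF C1_has_derivative[OF u]]) (use in_ball[OF that] rW in \<open>auto simp: W_def\<close>)
    obtain z where z: "s < z" "z < t"
      "u ((x0 - v) + t *\<^sub>R x) - u ((x0 - v) + s *\<^sub>R x) = (t - s) * ?D ((x0 - v) + z *\<^sub>R x) x"
      using MVT2[OF \<open>s < t\<close> der] by blast
    define y where "y = (x0 - v) + z *\<^sub>R x"
    have y: "y \<in> \<Omega>" "?D y v > \<eta>" "g y < B"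
      using in_ball[of z] rW z by (auto simp: W_def y_def)
    have "?D y x = ?D y v + ?D y (x - v)"
      using linear_add[OF lin[OF y(1)], of v "x - v"] by simp
    moreover have "\<bar>?D y (x - v)\<bar> \<le> r * B"
    proof -
      have "norm (x - v) * g y \<le> r * B"
        using that(4) y(3) r(1) by (intro mult_mono) (auto simp: g_def sum_nonneg)
      then show ?thesis using Dbound[OF y(1), of "x - v"] by linarith
    qed
    ultimately have "?D y x > 0"
      using y(2) r(2) by linarith
    moreover have "(t - s) * ?D y x = 0"
      using z(3) that by (simp add: S_def y_def)
    ultimately show False using \<open>s < t\<close> by simp
  qed
  have "negligible S"
  proof (rule starlike_negligible[OF \<open>closed S\<close>, of "x0 - v"])
    fix c x assume c: "(x0 - v) + c *\<^sub>R x \<in> S" "0 \<le> c" "(x0 - v) + x \<in> S"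
    \<comment> \<open>Parameter 1 gives a point of \<open>S\<close>, whose offset from
      \<open>x0\<close> is \<open>x - v\<close>.\<close>
    then have "norm (x - v) \<le> r"
      by (simp add: S_def dist_norm norm_minus_commute algebra_simps)
    then show "c = 1"
      using inj[of 1 c x] inj[of c 1 x] c by (metis linorder_neqE_linordered_idom scaleR_one)
  qed
  moreover have "?Z \<inter> ball x0 r \<subseteq> S" by (auto simp: S_def)
  ultimately have "negligible (?Z \<inter> ball x0 r)"
    using negligible_subset by blast
  moreover have "openin (top_of_set ?Z) (?Z \<inter> ball x0 r)" by auto
  moreover have "x0 \<in> ?Z \<inter> ball x0 r" using x0 r by simp
  ultimately show "\<exists>U. openin (top_of_set ?Z) U \<and> x0 \<in> U \<and> negligible U"
    by blast
qed

section \<open>Removal of the truncation\<close>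

lemma DERIV_max_0_power2: "((\<lambda>s::real. (max 0 s)\<^sup>2) has_real_derivative 2 * max 0 s) (at s)"
proof -
  consider "s < 0" | "s = 0" | "s > 0" by linarith
  then show ?thesis
  proof cases
    case 1
    have "((\<lambda>s. 0) has_real_derivative 2 * max 0 s) (at s)" using 1 by simp
    then show ?thesis
      by (rule has_field_derivative_transform_within_open[where S = "{..<0}"]) (use 1 in auto)
  next
    case 2
    have "((\<lambda>h::real. (max 0 h)\<^sup>2 / h) \<longlongrightarrow> 0) (at 0)"
    proof (rule Lim_null_comparison[where g = "\<lambda>h. \<bar>h\<bar>"])
      show "\<forall>\<^sub>F h::real in at 0. norm ((max 0 h)\<^sup>2 / h) \<le> \<bar>h\<bar>"
        by (intro always_eventually) (auto simp: max_def power2_eq_square)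
      show "((\<lambda>h::real. \<bar>h\<bar>) \<longlongrightarrow> 0) (at 0)"
        by (auto intro!: tendsto_eq_intros)
    qed
    then show ?thesis using 2 by (simp add: DERIV_def)
  next
    case 3
    have "((\<lambda>s. s\<^sup>2) has_real_derivative 2 * max 0 s) (at s)"
      using 3 by (auto intro!: derivative_eq_intros)
    then show ?thesis
      by (rule has_field_derivative_transform_within_open[where S = "{0<..}"]) (use 3 in auto)
  qed
qed

text \<open>The antiderivative vanishes for \<open>\<bar>s\<bar> < \<epsilon>\<close>; at \<open>s = 0\<close> this uses \<open>x / 0 = 0\<close>.\<close>

lemma DERIV_truncation:
  fixes \<epsilon> s :: real
  assumes "0 < \<epsilon>"
  shows "((\<lambda>s. ((max 0 (s - \<epsilon>))\<^sup>2 + (max 0 (- s - \<epsilon>))\<^sup>2) / s) has_real_derivative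
    1 - \<epsilon>\<^sup>2 / max (s\<^sup>2) (\<epsilon>\<^sup>2)) (at s)"
proof (cases "\<bar>s\<bar> < \<epsilon>")
  case True
  then have "s\<^sup>2 \<le> \<epsilon>\<^sup>2" using abs_le_square_iff[of s \<epsilon>] assms by simp
  then have "((\<lambda>s. 0) has_real_derivative 1 - \<epsilon>\<^sup>2 / max (s\<^sup>2) (\<epsilon>\<^sup>2)) (at s)"
    using assms by (simp add: max_def)
  then show ?thesis
    by (rule has_field_derivative_transform_within_open[where S = "{-\<epsilon><..<\<epsilon>}"]) (use True in \<open>auto simp: max_def\<close>)
next
  case False
  then have s: "s \<noteq> 0" and "\<epsilon>\<^sup>2 \<le> s\<^sup>2"
    using assms abs_le_square_iff[of \<epsilon> s] by auto
  have 1: "((\<lambda>s. (max 0 (s - \<epsilon>))\<^sup>2) has_real_derivative 2 * max 0 (s - \<epsilon>) * 1) (at s)"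
    by (rule DERIV_chain2[OF DERIV_max_0_power2]) (auto intro!: derivative_eq_intros)
  have 2: "((\<lambda>s. (max 0 (- s - \<epsilon>))\<^sup>2) has_real_derivative 2 * max 0 (- s - \<epsilon>) * (- 1)) (at s)"
    by (rule DERIV_chain2[OF DERIV_max_0_power2]) (auto intro!: derivative_eq_intros)
  \<comment> \<open>For \<open>s \<ge> \<epsilon>\<close> the function is
    \<open>s - 2 * \<epsilon> + \<epsilon>\<^sup>2 / s\<close>; for
    \<open>s \<le> - \<epsilon>\<close> it is the odd reflection of this.\<close>
  show ?thesis
  proof (rule DERIV_cong[OF DERIV_divide[OF DERIV_add[OF 1 2] DERIV_ident s]])
    show "((2 * max 0 (s - \<epsilon>) * 1 + 2 * max 0 (- s - \<epsilon>) * (- 1)) * s -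
         ((max 0 (s - \<epsilon>))\<^sup>2 + (max 0 (- s - \<epsilon>))\<^sup>2) * 1) / (s * s) = 1 - \<epsilon>\<^sup>2 / max (s\<^sup>2) (\<epsilon>\<^sup>2)"
      using False assms s \<open>\<epsilon>\<^sup>2 \<le> s\<^sup>2\<close>
      by (cases "s > 0") (auto simp: max_def power2_eq_square field_simps)
  qed
qed

text \<open>Truncate at levels \<open>\<epsilon> n\<close> tending to 0 and use dominated
  convergence. The factor \<open>\<theta> n (u x)\<close> tends to 1 where \<open>u x\<close> is
  nonzero and is 0 where \<open>u x = 0\<close>. At such zeros \<open>h x\<close> vanishes too if
  the derivative of \<open>u\<close> does; the other zeros form a negligible set.\<close>

lemma divergence_free_pairing:
  fixes \<Omega> :: "(real^'n) set" and u :: "real^'n \<Rightarrow> real" and a :: "'n \<Rightarrow> real^'n \<Rightarrow> real"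
  defines "h \<equiv> \<lambda>x. \<Sum>i\<in>UNIV. partial_deriv i u x * a i x"
  assumes \<Omega>: "open \<Omega>" "bounded \<Omega>"
    and u: "Ck_on (Suc 0) \<Omega> u" "continuous_on (closure \<Omega>) u" "\<And>x. x \<in> frontier \<Omega> \<Longrightarrow> u x = 0"
    and a: "\<And>i. Ck_on (Suc 0) \<Omega> (a i)" "\<And>x. x \<in> \<Omega> \<Longrightarrow> (\<Sum>i\<in>UNIV. partial_deriv i (a i) x) = 0"
    and bound: "\<And>x. x \<in> \<Omega> \<Longrightarrow> \<bar>h x\<bar> \<le> C"
  shows "integrable lborel (\<lambda>x. indicator \<Omega> x * h x)"
    and "integral\<^sup>L lborel (\<lambda>x. indicator \<Omega> x * h x) = 0"
proof -
  have hcont: "continuous_on \<Omega> h"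
    unfolding h_def partial_deriv_def
    by (intro continuous_intros C1_continuous_derivative[OF u(1)] C1_continuous[OF a(1)])
  have meas: "(\<lambda>x. indicator \<Omega> x * k x) \<in> borel_measurable lborel" if "continuous_on \<Omega> k" for k :: "_ \<Rightarrow> real"
    using borel_measurable_continuous_on_indicator[OF _ that] \<Omega>(1) by simp
  have "emeasure lborel \<Omega> < \<infinity>" using emeasure_bounded_finite[OF \<Omega>(2)] by simp
  then have intC: "integrable lborel (\<lambda>x. indicator \<Omega> x * C)"
    using \<Omega>(1) by (intro integrable_mult_left) (simp add: integrable_indicator_iff)
  show int: "integrable lborel (\<lambda>x. indicator \<Omega> x * h x)"
    by (rule Bochner_Integration.integrable_bound[OF intC meas[OF hcont]])
       (use bound in \<open>force simp: indicator_def\<close>)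
  define \<epsilon> where "\<epsilon> n = inverse (real (Suc n))" for n
  have \<epsilon>: "0 < \<epsilon> n" for n by (simp add: \<epsilon>_def)
  have \<epsilon>0: "\<epsilon> \<longlonglongrightarrow> 0" unfolding \<epsilon>_def by (rule LIMSEQ_inverse_real_of_nat)
  define \<theta> where "\<theta> n s = 1 - (\<epsilon> n)\<^sup>2 / max (s\<^sup>2) ((\<epsilon> n)\<^sup>2)" for n s
  have \<theta>c: "continuous_on UNIV (\<theta> n)" for n
    unfolding \<theta>_def using \<epsilon>[of n] by (intro continuous_intros) (auto simp: max_def not_le)
  have \<theta>b: "\<bar>\<theta> n s\<bar> \<le> 1" for n s
    using \<epsilon>[of n] by (auto simp: \<theta>_def max_def divide_simps)
  define k where "k n x = indicator \<Omega> x * (\<theta> n (u x) * h x)" for n x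
  have kc: "continuous_on \<Omega> (\<lambda>x. \<theta> n (u x) * h x)" for n
    by (intro continuous_intros hcont continuous_on_compose2[OF \<theta>c C1_continuous[OF u(1)]]) auto
  have k0: "integral\<^sup>L lborel (k n) = 0" for n
    unfolding k_def h_def
    by (rule divergence_free_truncation[OF \<Omega> u a DERIV_truncation[OF \<epsilon>[of n], folded \<theta>_def] \<theta>c \<epsilon>[of n]])
       (auto simp: max_def)
  let ?Z = "{x \<in> \<Omega>. u x = 0 \<and> frechet_derivative u (at x) \<noteq> (\<lambda>_. 0)}"
  have lim: "(\<lambda>n. k n x) \<longlonglongrightarrow> indicator \<Omega> x * h x" if "x \<notin> ?Z" for x
  proof (cases "x \<in> \<Omega> \<and> u x \<noteq> 0")
    case True
    have "(\<lambda>n. \<theta> n (u x)) \<longlonglongrightarrow> 1 - 0\<^sup>2 / max ((u x)\<^sup>2) (0\<^sup>2)"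
      unfolding \<theta>_def using True by (intro tendsto_intros \<epsilon>0) auto
    then have "(\<lambda>n. k n x) \<longlonglongrightarrow> indicator \<Omega> x * (1 * h x)"
      unfolding k_def by (intro tendsto_intros) simp
    then show ?thesis by simp
  next
    case False
    then have "indicator \<Omega> x * h x = 0"
      using that by (auto simp: h_def partial_deriv_def indicator_def)
    then show ?thesis by (auto simp: k_def indicator_def)
  qed
  \<comment> \<open>Negligible sets are null sets of the completed measure, so the limit is taken in
    \<open>lebesgue\<close> and the integrals are transferred back.\<close>
  have "(\<lambda>n. integral\<^sup>L lebesgue (k n)) \<longlonglongrightarrow> integral\<^sup>L lebesgue (\<lambda>x. indicator \<Omega> x * h x)"
  proof (rule integral_dominated_convergence)
    show "(\<lambda>x. indicator \<Omega> x * h x) \<in> borel_measurable lebesgue"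
      using meas[OF hcont] by (rule measurable_completion)
    show "k n \<in> borel_measurable lebesgue" for n
      unfolding k_def using meas[OF kc] by (rule measurable_completion)
    show "integrable lebesgue (\<lambda>x. indicator \<Omega> x * C)"
      using intC by (subst integrable_completion) auto
    have "?Z \<in> null_sets lebesgue"
      using negligible_regular_zero_set[OF \<Omega>(1) u(1)] by (simp only: negligible_iff_null_sets)
    from AE_not_in[OF this] show "AE x in lebesgue. (\<lambda>n. k n x) \<longlonglongrightarrow> indicator \<Omega> x * h x"
      by eventually_elim (rule lim)
    show "AE x in lebesgue. norm (k n x) \<le> indicator \<Omega> x * C" for n
    proof (rule AE_I2)
      fix x
      show "norm (k n x) \<le> indicator \<Omega> x * C"
      proof (cases "x \<in> \<Omega>")
        case True
        have "\<bar>\<theta> n (u x)\<bar> * \<bar>h x\<bar> \<le> 1 * C"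
          using \<theta>b bound[OF True] by (intro mult_mono) auto
        then show ?thesis using True by (simp add: k_def abs_mult)
      qed (simp add: k_def)
    qed
  qed
  moreover have "integral\<^sup>L lebesgue (k n) = 0" for n
    using k0[of n] meas[OF kc] unfolding k_def by (subst integral_completion) auto
  moreover have "integral\<^sup>L lebesgue (\<lambda>x. indicator \<Omega> x * h x) = integral\<^sup>L lborel (\<lambda>x. indicator \<Omega> x * h x)"
    by (rule integral_completion[OF meas[OF hcont]])
  ultimately show "integral\<^sup>L lborel (\<lambda>x. indicator \<Omega> x * h x) = 0"
    by (simp add: LIMSEQ_const_iff)
qed

subsection \<open>Solutions of the minimal surface system\<close>

definition jacobian :: "(real^'n \<Rightarrow> real^'m) \<Rightarrow> real^'n \<Rightarrow> real^'n^'m" where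
  "jacobian f x = (\<chi> \<alpha> i. partial_deriv i (\<lambda>y. f y $ \<alpha>) x)"

lemma gram_jacobian: "gram (jacobian f x) = induced_metric f x"
  by (simp add: gram_def jacobian_def induced_metric_def vec_eq_iff mat_def
      matrix_matrix_mult_def transpose_def)

text \<open>Symmetry of the inverse metric identifies row \<open>\<alpha>\<close> of the flux with
  the vector field inside the divergence in equation \<open>\<alpha>\<close> of the system.\<close>

lemma flux_jacobian:
  "flux (jacobian f x) $ \<alpha> $ i = (\<Sum>j\<in>UNIV. sqrt (det (induced_metric f x)) *
     matrix_inv (induced_metric f x) $ i $ j * partial_deriv j (\<lambda>z. f z $ \<alpha>) x)"
proof -
  have "matrix_inv (gram (jacobian f x)) $ j $ i = matrix_inv (gram (jacobian f x)) $ i $ j" for j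
    using transpose_inv_gram[of "jacobian f x"] by (simp add: transpose_def vec_eq_iff)
  then show ?thesis
    by (simp add: flux_def matrix_matrix_mult_def sum_distrib_left jacobian_def mult_ac
        flip: gram_jacobian)
qed

context
  fixes \<Omega> :: "(real^'n) set" and f :: "real^'n \<Rightarrow> real^'m"
  assumes \<Omega>: "open \<Omega>" and C2: "Ck_on 2 \<Omega> f"
begin

lemma C2_has_derivative: "x \<in> \<Omega> \<Longrightarrow> (f has_derivative frechet_derivative f (at x)) (at x)"
  using C2 by (simp add: numeral_2_eq_2 frechet_derivative_works[symmetric])

lemma frechet_derivative_component:
  assumes "x \<in> \<Omega>"
  shows "((\<lambda>y. f y $ \<alpha>) has_derivative (\<lambda>v. frechet_derivative f (at x) v $ \<alpha>)) (at x)"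
    and "frechet_derivative (\<lambda>y. f y $ \<alpha>) (at x) v = frechet_derivative f (at x) v $ \<alpha>"
proof -
  show D: "((\<lambda>y. f y $ \<alpha>) has_derivative (\<lambda>v. frechet_derivative f (at x) v $ \<alpha>)) (at x)"
    by (rule bounded_linear.has_derivative[OF bounded_linear_vec_nth C2_has_derivative[OF assms]])
  from frechet_derivative_at[OF D]
  show "frechet_derivative (\<lambda>y. f y $ \<alpha>) (at x) v = frechet_derivative f (at x) v $ \<alpha>"
    by metis
qed

lemma jacobian_mult:
  assumes "x \<in> \<Omega>"
  shows "jacobian f x *v v = frechet_derivative f (at x) v"
proof -
  have "jacobian f x = matrix (frechet_derivative f (at x))"
    using assms by (simp add: jacobian_def matrix_def partial_deriv_def frechet_derivative_component)
  then show ?thesis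
    using matrix_works[OF iffD2[OF linear_matrix_vector_mul_eq
        has_derivative_linear[OF C2_has_derivative[OF assms]]]] by simp
qed

lemma C1_frechet_derivative_component: "Ck_on (Suc 0) \<Omega> (\<lambda>x. frechet_derivative f (at x) v $ \<alpha>)"
proof -
  have D: "Ck_on (Suc 0) \<Omega> (\<lambda>x. frechet_derivative f (at x) v)"
    using C2 by (simp add: numeral_2_eq_2)
  show ?thesis
    by (rule C1_I[OF bounded_linear.has_derivative[OF bounded_linear_vec_nth C1_has_derivative[OF D]]])
       (auto intro!: continuous_intros C1_continuous_derivative[OF D])
qed

lemma C1_component: "Ck_on (Suc 0) \<Omega> (\<lambda>x. f x $ \<alpha>)"
  by (rule C1_I[OF frechet_derivative_component(1)])
     (auto intro: C1_continuous[OF C1_frechet_derivative_component])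

lemma C1_jacobian: "Ck_on (Suc 0) \<Omega> (\<lambda>x. jacobian f x $ \<alpha> $ i)"
  by (rule C1_cong[OF \<Omega> C1_frechet_derivative_component[of "axis i 1" \<alpha>]])
     (simp add: jacobian_def partial_deriv_def frechet_derivative_component)

lemma C1_flux_jacobian: "Ck_on (Suc 0) \<Omega> (\<lambda>x. flux (jacobian f x) $ \<alpha> $ i)"
  by (rule flux_entry_C1[OF \<Omega> C1_jacobian])

lemma contraction_jacobian:
  assumes "distance_decreasing_on \<Omega> f" "x \<in> \<Omega>"
  shows "contraction (jacobian f x)"
  unfolding contraction_def jacobian_mult[OF assms(2)]
proof
  fix v
  show "norm (frechet_derivative f (at x) v) \<le> norm v"
    using assms linear_0[OF has_derivative_linear[OF C2_has_derivative[OF assms(2)]]]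
    by (cases "v = 0") (auto simp: distance_decreasing_on_def)
qed

text \<open>The system differentiates every summand over \<open>j\<close> separately. Each summand
  is continuously differentiable, so its \<open>frechet_derivative\<close> is a genuine derivative
  and the sum may be taken inside.\<close>

lemma divergence_flux_jacobian:
  assumes "minimal_surface_system \<Omega> f" "x \<in> \<Omega>"
  shows "(\<Sum>i\<in>UNIV. partial_deriv i (\<lambda>y. flux (jacobian f y) $ \<alpha> $ i) x) = 0"
proof -
  let ?a = "\<lambda>i j y. sqrt (det (induced_metric f y)) * matrix_inv (induced_metric f y) $ i $ j *
     partial_deriv j (\<lambda>z. f z $ \<alpha>) y"
  have a: "Ck_on (Suc 0) \<Omega> (?a i j)" for i j
  proof -
    have "Ck_on (Suc 0) \<Omega> (\<lambda>y. sqrt (det (gram (jacobian f y))) *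
        matrix_inv (gram (jacobian f y)) $ i $ j * jacobian f y $ \<alpha> $ j)"
      by (intro C1_mult C1_sqrt C1_det gram_entry_C1 C1_matrix_inv C1_jacobian \<Omega> det_gram_pos
          less_imp_neq[OF det_gram_pos, symmetric])
    then show ?thesis
      unfolding gram_jacobian by (simp add: jacobian_def del: Ck_on.simps)
  qed
  have D: "((\<lambda>y. \<Sum>j\<in>UNIV. ?a i j y) has_derivative
      (\<lambda>v. \<Sum>j\<in>UNIV. frechet_derivative (?a i j) (at x) v)) (at x)" for i
    by (intro has_derivative_sum C1_has_derivative[OF a assms(2)])
  have "partial_deriv i (\<lambda>y. flux (jacobian f y) $ \<alpha> $ i) x = (\<Sum>j\<in>UNIV. partial_deriv i (?a i j) x)" for i
    unfolding flux_jacobian partial_deriv_def[of i]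
    by (rule fun_cong[OF frechet_derivative_at[OF D], symmetric])
  then show ?thesis
    using assms by (simp add: minimal_surface_system_def)
qed

end

section \<open>Uniform bounds and vanishing of a nonnegative integrand\<close>

text \<open>Boundedness follows from \<open>p = p ** mat 1\<close>, since a contraction does not
  increase the Frobenius norm; closedness is checked one test vector at a time.\<close>

lemma compact_contractions: "compact {p :: real^'n^'m. contraction p}"
  unfolding compact_eq_bounded_closed
proof
  have "norm p \<le> norm (mat 1 :: real^'n^'n)" if "contraction p" for p :: "real^'n^'m"
    using contraction_mult_left[OF that, of "mat 1"] by simp
  then show "bounded {p :: real^'n^'m. contraction p}"
    unfolding bounded_iff by auto
  have "{p :: real^'n^'m. contraction p} = (\<Inter>v. {p. norm (p *v v) \<le> norm v})"
    by (auto simp: contraction_def)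
  moreover have "closed {p :: real^'n^'m. norm (p *v v) \<le> norm v}" for v
  proof -
    have "linear (\<lambda>p :: real^'n^'m. p *v v)"
      by (intro linearI) (simp_all add: matrix_vector_mult_add_rdistrib scaleR_matrix_vector_assoc)
    then show ?thesis
      by (intro closed_Collect_le continuous_intros linear_continuous_on)
         (simp add: linear_conv_bounded_linear)
  qed
  ultimately show "closed {p :: real^'n^'m. contraction p}" by auto
qed

text \<open>Continuity on a compact set. This supplies a dominating constant however the derivatives
  of the solutions behave near the frontier.\<close>

lemma flux_bounded_on_contractions:
  obtains B where "\<And>p :: real^'n^'m. contraction p \<Longrightarrow> norm (flux p) \<le> B"
proof -
  have "continuous_on UNIV (\<lambda>p :: real^'n^'m. flux p $ a $ i)" for a i
    by (intro C1_continuous flux_entry_C1[OF open_UNIV] C1_linear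
        bounded_linear_compose[OF bounded_linear_vec_nth bounded_linear_vec_nth])
  then have "continuous_on UNIV (\<lambda>p :: real^'n^'m. \<chi> a i. flux p $ a $ i)"
    by (intro continuous_on_vec_lambda)
  then have "continuous_on UNIV (flux :: real^'n^'m \<Rightarrow> _)" by simp
  then have "bounded (flux ` {p :: real^'n^'m. contraction p})"
    by (intro compact_imp_bounded compact_continuous_image compact_contractions)
       (auto intro: continuous_on_subset)
  then show ?thesis
    using that unfolding bounded_iff by auto
qed

text \<open>A positive value would persist on a nonempty open set, which the vanishing integral
  would make negligible.\<close>

lemma continuous_nonneg_integral_zero:
  fixes g :: "'a::euclidean_space \<Rightarrow> real"
  assumes "open S" "continuous_on S g" "\<And>x. x \<in> S \<Longrightarrow> 0 \<le> g x"
    and "integrable lborel (\<lambda>x. indicator S x * g x)" "integral\<^sup>L lborel (\<lambda>x. indicator S x * g x) = 0"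
    and "x \<in> S"
  shows "g x = 0"
proof (rule ccontr)
  assume "g x \<noteq> 0"
  define T where "T = S \<inter> g -` {0<..}"
  have T: "open T" "x \<in> T"
    unfolding T_def using assms \<open>g x \<noteq> 0\<close>
    by (auto intro!: continuous_open_preimage simp: less_le)
  have "AE x in lborel. indicator S x * g x = 0"
    using integral_nonneg_eq_0_iff_AE[OF assms(4)] assms(3,5) by (simp add: indicator_def)
  then have "AE x in lborel. x \<notin> T"
    by eventually_elim (auto simp: T_def)
  then have "T \<in> null_sets lborel"
    using T(1) by (subst (asm) AE_iff_null_sets[symmetric]) auto
  then have "negligible T"
    unfolding negligible_iff_null_sets by (rule null_sets_completionI)
  then show False
    using open_not_negligible[OF T(1)] T(2) by blast
qed

section \<open>Uniqueness for given boundary values\<close>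

theorem theoremB:
  fixes \<Omega> :: "(real^'n) set"
    and f\<^sub>0 f\<^sub>1 :: "real^'n \<Rightarrow> real^'m"
    and \<Sigma>\<^sub>0 \<Sigma>\<^sub>1 :: "((real^'n) \<times> (real^'m)) set"
  assumes "open \<Omega>" and "connected \<Omega>" and "\<Omega> \<noteq> {}" and "bounded \<Omega>"
    and "nonparametric_minimal_submanifold \<Omega> f\<^sub>0 \<Sigma>\<^sub>0"
    and "nonparametric_minimal_submanifold \<Omega> f\<^sub>1 \<Sigma>\<^sub>1"
    and "distance_decreasing_on \<Omega> f\<^sub>0"
    and "distance_decreasing_on \<Omega> f\<^sub>1"
    and "continuous_on (closure \<Omega>) f\<^sub>0"
    and "continuous_on (closure \<Omega>) f\<^sub>1"
    and "\<forall>x\<in>frontier \<Omega>. f\<^sub>0 x = f\<^sub>1 x"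
  shows "\<Sigma>\<^sub>0 = \<Sigma>\<^sub>1"
proof -
  note \<Omega> = \<open>open \<Omega>\<close>
  have ms: "minimal_surface_system \<Omega> f\<^sub>0" "minimal_surface_system \<Omega> f\<^sub>1"
    and \<Sigma>: "\<Sigma>\<^sub>0 = graph_over \<Omega> f\<^sub>0" "\<Sigma>\<^sub>1 = graph_over \<Omega> f\<^sub>1"
    using assms(5,6) by (auto simp: nonparametric_minimal_submanifold_def)
  then have C2: "Ck_on 2 \<Omega> f\<^sub>0" "Ck_on 2 \<Omega> f\<^sub>1"
    by (auto simp: minimal_surface_system_def)
  define P where "P x = jacobian f\<^sub>0 x" for x
  define Q where "Q x = jacobian f\<^sub>1 x - jacobian f\<^sub>0 x" for x
  have PQ: "P x + Q x = jacobian f\<^sub>1 x" for x by (simp add: P_def Q_def)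
  define A where "A x = flux (P x + Q x) - flux (P x)" for x
  define u where "u \<alpha> x = f\<^sub>1 x $ \<alpha> - f\<^sub>0 x $ \<alpha>" for \<alpha> x
  have con: "contraction (P x)" "contraction (P x + Q x)" if "x \<in> \<Omega>" for x
    unfolding PQ unfolding P_def using contraction_jacobian[OF \<Omega>] C2 assms(7,8) that by auto
  have C1_diff: "Ck_on (Suc 0) \<Omega> (\<lambda>x. k x - l x)"
    if "Ck_on (Suc 0) \<Omega> k" "Ck_on (Suc 0) \<Omega> l" for k l :: "real^'n \<Rightarrow> real"
    using C1_add[OF that(1) C1_mult[OF C1_const[of \<Omega> "-1"] that(2)]] by simp
  have u_C1: "Ck_on (Suc 0) \<Omega> (u \<alpha>)" for \<alpha>
    unfolding u_def by (intro C1_diff C1_component[OF \<Omega>] C2)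
  have a_C1: "Ck_on (Suc 0) \<Omega> (\<lambda>x. A x $ \<alpha> $ i)" for \<alpha> i
    unfolding A_def PQ unfolding P_def vector_minus_component
    by (intro C1_diff C1_flux_jacobian[OF \<Omega>] C2)
  have partial_diff: "partial_deriv i (\<lambda>x. k x - l x) x = partial_deriv i k x - partial_deriv i l x"
    if "Ck_on (Suc 0) \<Omega> k" "Ck_on (Suc 0) \<Omega> l" "x \<in> \<Omega>" for i k l x
    using frechet_derivative_at[OF has_derivative_diff[OF C1_has_derivative[OF that(1,3)] C1_has_derivative[OF that(2,3)]]]
    by (simp add: partial_deriv_def fun_eq_iff)
  have Du: "partial_deriv i (u \<alpha>) x = Q x $ \<alpha> $ i" if "x \<in> \<Omega>" for i \<alpha> x
    unfolding u_def partial_diff[OF C1_component[OF \<Omega> C2(2)] C1_component[OF \<Omega> C2(1)] that]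
    by (simp add: Q_def jacobian_def)
  have div: "(\<Sum>i\<in>UNIV. partial_deriv i (\<lambda>x. A x $ \<alpha> $ i) x) = 0" if "x \<in> \<Omega>" for \<alpha> x
    unfolding A_def PQ unfolding P_def vector_minus_component
      partial_diff[OF C1_flux_jacobian[OF \<Omega> C2(2)] C1_flux_jacobian[OF \<Omega> C2(1)] that]
    using divergence_flux_jacobian[OF \<Omega> C2(1) ms(1) that] divergence_flux_jacobian[OF \<Omega> C2(2) ms(2) that]
    by (simp add: sum_subtractf)
  define h where "h \<alpha> x = (\<Sum>i\<in>UNIV. partial_deriv i (u \<alpha>) x * A x $ \<alpha> $ i)" for \<alpha> x
  have h: "h \<alpha> x = Q x $ \<alpha> \<bullet> A x $ \<alpha>" if "x \<in> \<Omega>" for \<alpha> x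
    using that by (simp add: h_def Du inner_vec_def)
  obtain B where B: "\<And>p :: real^'n^'m. contraction p \<Longrightarrow> norm (flux p) \<le> B"
    using flux_bounded_on_contractions by blast
  obtain B' where B': "\<And>p :: real^'n^'m. contraction p \<Longrightarrow> norm p \<le> B'"
    using compact_imp_bounded[OF compact_contractions] by (auto simp: bounded_iff)
  \<comment> \<open>The distance-decreasing property makes both Jacobians contractions, so they and
    their fluxes are uniformly bounded.\<close>
  have bound: "\<bar>h \<alpha> x\<bar> \<le> (B' + B') * (B + B)" if "x \<in> \<Omega>" for \<alpha> x
  proof -
    have Qb: "norm (Q x) \<le> B' + B'"
      using norm_triangle_ineq4[of "P x + Q x" "P x"] B'[OF con(1)[OF that]] B'[OF con(2)[OF that]] by simp
    have Ab: "norm (A x) \<le> B + B"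
      using norm_triangle_ineq4[of "flux (P x + Q x)" "flux (P x)"] B[OF con(1)[OF that]] B[OF con(2)[OF that]]
      by (simp add: A_def)
    have "\<bar>h \<alpha> x\<bar> \<le> norm (Q x $ \<alpha>) * norm (A x $ \<alpha>)"
      unfolding h[OF that] by (rule Cauchy_Schwarz_ineq2)
    also have "\<dots> \<le> norm (Q x) * norm (A x)"
      by (intro mult_mono Finite_Cartesian_Product.norm_nth_le) simp_all
    also have "\<dots> \<le> (B' + B') * (B + B)"
      by (rule mult_mono[OF Qb Ab order_trans[OF norm_ge_zero Qb] norm_ge_zero])
    finally show ?thesis .
  qed
  have u_cont: "continuous_on (closure \<Omega>) (u \<alpha>)" for \<alpha>
    unfolding u_def by (intro continuous_intros assms(9,10))
  \<comment> \<open>Each component is tested with the scalar truncation of its own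
    \<open>u \<alpha>\<close>, which vanishes on the frontier because the boundary values
    agree.\<close>
  have pairing: "integrable lborel (\<lambda>x. indicator \<Omega> x * h \<alpha> x)"
    "integral\<^sup>L lborel (\<lambda>x. indicator \<Omega> x * h \<alpha> x) = 0" for \<alpha>
    using divergence_free_pairing[OF \<Omega> \<open>bounded \<Omega>\<close> u_C1 u_cont _ a_C1 div bound[unfolded h_def]]
      assms(11) by (simp_all add: h_def u_def)
  \<comment> \<open>Adding the components restores the full Frobenius pairing, whose sign
    monotonicity controls; a single \<open>h \<alpha>\<close> need not have a sign.\<close>
  define g where "g x = (\<Sum>\<alpha>\<in>UNIV. h \<alpha> x)" for x
  have g: "g x = A x \<bullet> Q x" if "x \<in> \<Omega>" for x
    using that by (simp add: g_def h inner_vec_def[of "A x"] inner_commute)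
  have Q0: "Q x = 0" if "x \<in> \<Omega>" for x
  proof -
    have "g x = 0"
    proof (rule continuous_nonneg_integral_zero[OF \<Omega> _ _ _ _ that])
      show "continuous_on \<Omega> g"
        unfolding g_def h_def partial_deriv_def
        by (intro continuous_intros C1_continuous_derivative[OF u_C1] C1_continuous[OF a_C1])
      show "0 \<le> g y" if "y \<in> \<Omega>" for y
        unfolding g[OF that] A_def by (rule flux_strict_mono(1)[OF con[OF that]])
      have eq: "(\<lambda>x. indicator \<Omega> x * g x) = (\<lambda>x. \<Sum>\<alpha>\<in>UNIV. indicator \<Omega> x * h \<alpha> x)"
        by (simp add: g_def sum_distrib_left)
      show "integrable lborel (\<lambda>x. indicator \<Omega> x * g x)"
        unfolding eq by (intro Bochner_Integration.integrable_sum pairing)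
      show "integral\<^sup>L lborel (\<lambda>x. indicator \<Omega> x * g x) = 0"
        unfolding eq by (subst Bochner_Integration.integral_sum) (simp_all only: pairing sum.neutral_const)
    qed
    then show ?thesis
      using flux_strict_mono(2)[OF con[OF that]] g[OF that] by (simp add: A_def)
  qed
  let ?w = "\<lambda>x. f\<^sub>1 x - f\<^sub>0 x"
  have "(?w has_derivative (\<lambda>_. 0)) (at x within \<Omega>)" if "x \<in> \<Omega>" for x
  proof -
    have "frechet_derivative f\<^sub>1 (at x) v - frechet_derivative f\<^sub>0 (at x) v = Q x *v v" for v
      using that by (simp add: Q_def matrix_vector_mult_diff_rdistrib jacobian_mult[OF \<Omega> C2(1)]
          jacobian_mult[OF \<Omega> C2(2)])
    then have "frechet_derivative f\<^sub>1 (at x) v - frechet_derivative f\<^sub>0 (at x) v = 0" for v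
      using Q0[OF that] by simp
    then have "(?w has_derivative (\<lambda>_. 0)) (at x)"
      using has_derivative_diff[OF C2_has_derivative[OF \<Omega> C2(2) that] C2_has_derivative[OF \<Omega> C2(1) that]] by simp
    then show ?thesis by (rule has_derivative_at_withinI)
  qed
  moreover have w_cont: "continuous_on (closure \<Omega>) ?w"
    by (intro continuous_intros assms(9,10))
  ultimately have "?w constant_on \<Omega>"
    using \<Omega> \<open>connected \<Omega>\<close> continuous_on_subset[OF w_cont closure_subset]
    by (intro has_derivative_zero_connected_constant_on[of \<Omega> "{}"]) auto
  then obtain k where k: "\<And>x. x \<in> \<Omega> \<Longrightarrow> ?w x = k"
    unfolding constant_on_def by blast
  \<comment> \<open>A nonempty bounded set is not the whole space, so it has a frontier point; there
    the constant difference, carried over by continuity, is 0.\<close>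
  have "frontier \<Omega> \<noteq> {}"
    using assms(3,4) frontier_eq_empty not_bounded_UNIV by blast
  then obtain y where y: "y \<in> frontier \<Omega>" by blast
  have "?w y = k"
    by (rule continuous_constant_on_closure[OF w_cont k]) (use y in \<open>auto simp: frontier_def\<close>)
  then have "k = 0" using y assms(11) by simp
  then have "f\<^sub>0 x = f\<^sub>1 x" if "x \<in> \<Omega>" for x
    using k[OF that] by simp
  then show ?thesis
    unfolding \<Sigma> graph_over_def by force
qed

end
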